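(* In the finite setting described in the context, let $(\theta_k,\zeta_k)_{k\ge0}$ be generated by the exact robust policy ascent algorithm described in the context, and call $\{k\ge0:\Delta_k\le\zeta_k\}$ the set of refinement iterations. Then $(J(\theta_k))_{k\ge0}$ is nondecreasing and convergent, there are infinitely many refinement iterations, $\zeta_k\to0$ as $k\to\infty$, and every accumulation point $\bar\theta$ of the refinement iterates $\{\theta_k:\Delta_k\le\zeta_k\}$ is directionally stationary, i.e. $D_\theta^+J(\bar\theta)[r]\le0$ for all $r\in T_0(\bar\theta)$.
   Context: $\mathcal X\subset\mathbb R^d$, $A\subset\mathbb R^m$ nonempty finite; $T\ge1$ an integer; $\mathcal T=\{0,\dots,T-1\}$; $q\ge1$ an integer; $\varepsilon>0$; $W_q$ the $q$-Wasserstein distance on $\mathcal P(\mathcal X)$ for the Euclidean metric; rewards $f:\mathcal T\times\mathcal X\times A\times\mathcal X\to\mathbb R$, $g:\mathcal X\to\mathbb R$; nominal laws $\mathbb P_t^0(x,a,\cdot)\in\mathcal P(\mathcal X)$; initial law $\mu_0\in\mathcal P(\mathcal X)$; $\mathbb B_t(x,a)=\{\mathbb P:W_q(\mathbb P,\mathbb P_t^0(x,a,\cdot))\le\varepsilon\}$. $\Theta=[-B,B]^{d_\theta}$ with $B>0$; $\pi_t^\theta(x,\cdot)$ is a probability mass function on $A$, and each $\pi_t^\theta(x,a)$ is strictly positive and $C^2$ in $\theta$ near $\Theta$. Write $\langle\mathbb P,\phi\rangle=\sum_{y\in\mathcal X}\mathbb P(\{y\})\phi(y)$. Robust values: $V_T^\theta=g$,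 $G_t^\theta(x,a)=\min_{\mathbb P\in\mathbb B_t(x,a)}\langle\mathbb P,f(t,x,a,\cdot)+V_{t+1}^\theta\rangle$, $V_t^\theta(x)=\sum_a\pi_t^\theta(x,a)G_t^\theta(x,a)$, $J(\theta)=\sum_x\mu_0(\{x\})V_0^\theta(x)$. Selections: each ball $\mathbb B_t(x,a)$ is a polytope with finite vertex set $\mathcal V_t(x,a)$; $\Sigma=\prod_{(t,x,a)}\mathcal V_t(x,a)$ is the finite set of maps $\sigma$ with $\sigma(t,x,a)\in\mathcal V_t(x,a)$. For $\sigma\in\Sigma$, $V_t^{\sigma,\theta}$ is the value function of $\pi^\theta$ in the non-robust MDP with transition kernels $\sigma(t,x,a)$, and $J_\sigma(\theta)=\sum_x\mu_0(\{x\})V_0^{\sigma,\theta}(x)$. Gaps: $g_t^{\sigma,\theta}(x,a)=\langle\sigma(t,x,a),f(t,x,a,\cdot)+V_{t+1}^\theta\rangle-G_t^\theta(x,a)$. For $\zeta\ge0$, $S_\zeta(\theta)=\{\sigma\in\Sigma:g_t^{\sigma,\theta}(x,a)\le\zeta\ \forall(t,x,a)\}$. $\zeta$-active feasible directions: $T_\zeta(\theta)=\{r\in\mathbb R^{d_\theta}:\|r\|_\infty\le1,\ r_i\le0\text{ if }\theta_i\ge B-\zeta,\ r_i\ge0\text{ if }\theta_i\le-B+\zeta\}$. Constants: $C_1,C_2>0$ are constants such that $|g_t^{\sigma,\theta}(x,a)-g_t^{\sigma,\theta'}(x,a)|\le C_1\|\theta-\theta'\|_\infty$ for all $\sigma,(t,x,a),\theta,\theta'\in\Theta$,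 and $|J_\sigma(\theta+hr)-J_\sigma(\theta)-h\langle\nabla_\theta J_\sigma(\theta),r\rangle|\le C_2h^2$ for all $\sigma$, $\|r\|_\infty\le1$, $\theta,\theta+hr\in\Theta$ (such constants exist). Algorithm (exact robust policy ascent). Inputs $\theta_0\in\Theta$, $\zeta_0>0$, $\nu\in(0,1)$. For $k=0,1,2,\dots$: let $\Delta_k=\max_{r\in T_{\zeta_k}(\theta_k)}\min_{\sigma\in S_{\zeta_k}(\theta_k)}\langle\nabla_\theta J_\sigma(\theta_k),r\rangle$ and let $r_k$ be a maximizer. If $\Delta_k\le\zeta_k$ (refinement): $\theta_{k+1}=\theta_k$, $\zeta_{k+1}=\nu\zeta_k$. Otherwise (ascent): $\theta_{k+1}=\theta_k+h_kr_k$ with $h_k=\min\{\zeta_k,\zeta_k/C_1,\Delta_k/(2C_2)\}$ and $\zeta_{k+1}=\zeta_k$. All quantities are computed exactly. $D_\theta^+J(\theta)[r]=\lim_{h\downarrow0}(J(\theta+hr)-J(\theta))/h$. *)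

theory Defs
  imports "HOL-Analysis.Analysis" "HOL-Analysis.Finite_Function_Topology"
    "HOL-Probability.Probability_Mass_Function"
begin

text \<open>
  Probability measures on a finite set \<open>X\<close> of points of Euclidean space are PMFs \<open>p\<close> with
  \<open>set_pmf p \<subseteq> X\<close>.
\<close>

definition couplings :: "'a pmf \<Rightarrow> 'a pmf \<Rightarrow> ('a \<times> 'a) pmf set" where
  "couplings p p' = {\<gamma>. map_pmf fst \<gamma> = p \<and> map_pmf snd \<gamma> = p'}"

definition wasserstein :: "nat \<Rightarrow> 'a::metric_space pmf \<Rightarrow> 'a pmf \<Rightarrow> real" where
  "wasserstein q p p' =
     root q (INF \<gamma>\<in>couplings p p'. measure_pmf.expectation \<gamma> (\<lambda>(x, y). dist x y ^ q))"

text \<open>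
  A PMF of finite support as an element of the real vector space of finitely supported functions;
  the value is meaningless if the support is infinite.
\<close>

definition pmf_vec :: "'a pmf \<Rightarrow> 'a \<Rightarrow>\<^sub>0 real" where
  "pmf_vec p = Abs_poly_mapping (pmf p)"

definition C2_on :: "('a::euclidean_space) set \<Rightarrow> ('a \<Rightarrow> real) \<Rightarrow> bool" where
  "C2_on U \<phi> \<longleftrightarrow>
     (\<exists>(\<phi>' :: 'a \<Rightarrow> 'a \<Rightarrow>\<^sub>L real) (\<phi>'' :: 'a \<Rightarrow> 'a \<Rightarrow>\<^sub>L 'a \<Rightarrow>\<^sub>L real).
        (\<forall>x\<in>U. (\<phi> has_derivative blinfun_apply (\<phi>' x)) (at x)) \<and>
        (\<forall>x\<in>U. (\<phi>' has_derivative blinfun_apply (\<phi>'' x)) (at x)) \<and>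
        continuous_on U \<phi>'')"

definition gradient :: "('a::real_inner \<Rightarrow> real) \<Rightarrow> 'a \<Rightarrow> 'a" where
  "gradient \<phi> x = (THE D. GDERIV \<phi> x :> D)"

definition has_right_dir_derivative ::
  "('a::real_vector \<Rightarrow> real) \<Rightarrow> 'a \<Rightarrow> 'a \<Rightarrow> real \<Rightarrow> bool" where
  "has_right_dir_derivative \<phi> x r D \<longleftrightarrow>
     ((\<lambda>h. (\<phi> (x + h *\<^sub>R r) - \<phi> x) / h) \<longlongrightarrow> D) (at_right 0)"


section \<open>Robust finite-horizon decision problems\<close>

record ('d, 'm, 'n) rmdp =
  states :: "(real ^ 'd::finite) set"
  actions :: "(real ^ 'm::finite) set"
  horizon :: nat
  worder :: nat
  radius :: real
  reward :: "nat \<Rightarrow> real ^ 'd \<Rightarrow> real ^ 'm \<Rightarrow> real ^ 'd \<Rightarrow> real"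
  final_reward :: "real ^ 'd \<Rightarrow> real"
  nominal :: "nat \<Rightarrow> real ^ 'd \<Rightarrow> real ^ 'm \<Rightarrow> (real ^ 'd) pmf"
  init :: "(real ^ 'd) pmf"
  box_bound :: real
  policy :: "nat \<Rightarrow> real ^ 'n::finite \<Rightarrow> real ^ 'd \<Rightarrow> real ^ 'm \<Rightarrow> real"

definition param_box :: "('d::finite, 'm::finite, 'n::finite) rmdp \<Rightarrow> (real ^ 'n) set" where
  "param_box M = {\<theta>. \<forall>i. - box_bound M \<le> \<theta> $ i \<and> \<theta> $ i \<le> box_bound M}"

definition finite_robust_mdp :: "('d::finite, 'm::finite, 'n::finite) rmdp \<Rightarrow> bool" where
  "finite_robust_mdp M \<longleftrightarrow>
     finite (states M) \<and> states M \<noteq> {} \<and>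
     finite (actions M) \<and> actions M \<noteq> {} \<and>
     1 \<le> horizon M \<and> 1 \<le> worder M \<and> 0 < radius M \<and> 0 < box_bound M \<and>
     set_pmf (init M) \<subseteq> states M \<and>
     (\<forall>t<horizon M. \<forall>x\<in>states M. \<forall>a\<in>actions M. set_pmf (nominal M t x a) \<subseteq> states M) \<and>
     (\<forall>t<horizon M. \<forall>\<theta>\<in>param_box M. \<forall>x\<in>states M.
        (\<forall>a\<in>actions M. 0 \<le> policy M t \<theta> x a) \<and> (\<Sum>a\<in>actions M. policy M t \<theta> x a) = 1) \<and>
     (\<exists>U. open U \<and> param_box M \<subseteq> U \<and>
        (\<forall>t<horizon M. \<forall>x\<in>states M. \<forall>a\<in>actions M.
           (\<forall>\<theta>\<in>U. 0 < policy M t \<theta> x a) \<and> C2_on U (\<lambda>\<theta>. policy M t \<theta> x a)))"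

definition pairing ::
  "('d::finite, 'm::finite, 'n::finite) rmdp \<Rightarrow> (real ^ 'd) pmf \<Rightarrow> (real ^ 'd \<Rightarrow> real) \<Rightarrow> real" where
  "pairing M P \<phi> = (\<Sum>y\<in>states M. pmf P y * \<phi> y)"

definition ambiguity_ball ::
  "('d::finite, 'm::finite, 'n::finite) rmdp \<Rightarrow> nat \<Rightarrow> real ^ 'd \<Rightarrow> real ^ 'm \<Rightarrow> (real ^ 'd) pmf set"
where
  "ambiguity_ball M t x a =
     {P. set_pmf P \<subseteq> states M \<and> wasserstein (worder M) P (nominal M t x a) \<le> radius M}"

text \<open>The ball is compact and nonempty, so the infimum below is a minimum.\<close>

definition robust_min ::
  "('d::finite, 'm::finite, 'n::finite) rmdp \<Rightarrow> nat \<Rightarrow> real ^ 'd \<Rightarrow> real ^ 'm \<Rightarrow> (real ^ 'd \<Rightarrow> real) \<Rightarrow> real"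
where
  "robust_min M t x a v =
     (INF P\<in>ambiguity_ball M t x a. pairing M P (\<lambda>y. reward M t x a y + v y))"

function robust_value ::
  "('d::finite, 'm::finite, 'n::finite) rmdp \<Rightarrow> real ^ 'n \<Rightarrow> nat \<Rightarrow> real ^ 'd \<Rightarrow> real" where
  "robust_value M \<theta> t =
     (if t < horizon M
      then (\<lambda>x. \<Sum>a\<in>actions M. policy M t \<theta> x a * robust_min M t x a (robust_value M \<theta> (Suc t)))
      else final_reward M)"
  by pat_completeness auto
termination by (relation "Wellfounded.measure (\<lambda>(M, \<theta>, t). horizon M - t)") auto

declare robust_value.simps [simp del]

definition robust_q ::
  "('d::finite, 'm::finite, 'n::finite) rmdp \<Rightarrow> real ^ 'n \<Rightarrow> nat \<Rightarrow> real ^ 'd \<Rightarrow> real ^ 'm \<Rightarrow> real" where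
  "robust_q M \<theta> t x a = robust_min M t x a (robust_value M \<theta> (Suc t))"

definition robust_objective ::
  "('d::finite, 'm::finite, 'n::finite) rmdp \<Rightarrow> real ^ 'n \<Rightarrow> real" where
  "robust_objective M \<theta> = (\<Sum>x\<in>states M. pmf (init M) x * robust_value M \<theta> 0 x)"


section \<open>Vertex selections\<close>

definition ball_vertices ::
  "('d::finite, 'm::finite, 'n::finite) rmdp \<Rightarrow> nat \<Rightarrow> real ^ 'd \<Rightarrow> real ^ 'm \<Rightarrow> (real ^ 'd) pmf set"
where
  "ball_vertices M t x a =
     {P \<in> ambiguity_ball M t x a. pmf_vec P extreme_point_of (pmf_vec ` ambiguity_ball M t x a)}"

type_synonym ('d, 'm) selection = "nat \<times> (real ^ 'd) \<times> (real ^ 'm) \<Rightarrow> (real ^ 'd) pmf"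

definition selections ::
  "('d::finite, 'm::finite, 'n::finite) rmdp \<Rightarrow> ('d, 'm) selection set" where
  "selections M =
     (\<Pi>\<^sub>E (t, x, a) \<in> {..<horizon M} \<times> states M \<times> actions M. ball_vertices M t x a)"

function selection_value ::
  "('d::finite, 'm::finite, 'n::finite) rmdp \<Rightarrow> ('d, 'm) selection \<Rightarrow> real ^ 'n \<Rightarrow> nat \<Rightarrow> real ^ 'd \<Rightarrow> real"
where
  "selection_value M \<sigma> \<theta> t =
     (if t < horizon M
      then (\<lambda>x. \<Sum>a\<in>actions M. policy M t \<theta> x a *
              pairing M (\<sigma> (t, x, a)) (\<lambda>y. reward M t x a y + selection_value M \<sigma> \<theta> (Suc t) y))
      else final_reward M)"
  by pat_completeness auto
termination by (relation "Wellfounded.measure (\<lambda>(M, \<sigma>, \<theta>, t). horizon M - t)") auto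

declare selection_value.simps [simp del]

definition selection_objective ::
  "('d::finite, 'm::finite, 'n::finite) rmdp \<Rightarrow> ('d, 'm) selection \<Rightarrow> real ^ 'n \<Rightarrow> real" where
  "selection_objective M \<sigma> \<theta> = (\<Sum>x\<in>states M. pmf (init M) x * selection_value M \<sigma> \<theta> 0 x)"

definition gap ::
  "('d::finite, 'm::finite, 'n::finite) rmdp \<Rightarrow> ('d, 'm) selection \<Rightarrow> real ^ 'n
     \<Rightarrow> nat \<Rightarrow> real ^ 'd \<Rightarrow> real ^ 'm \<Rightarrow> real" where
  "gap M \<sigma> \<theta> t x a =
     pairing M (\<sigma> (t, x, a)) (\<lambda>y. reward M t x a y + robust_value M \<theta> (Suc t) y)
       - robust_q M \<theta> t x a"

definition near_active ::
  "('d::finite, 'm::finite, 'n::finite) rmdp \<Rightarrow> real \<Rightarrow> real ^ 'n \<Rightarrow> ('d, 'm) selection set" where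
  "near_active M \<zeta> \<theta> =
     {\<sigma> \<in> selections M. \<forall>t<horizon M. \<forall>x\<in>states M. \<forall>a\<in>actions M. gap M \<sigma> \<theta> t x a \<le> \<zeta>}"


section \<open>Exact robust policy ascent\<close>

text \<open>On \<open>real ^ 'n\<close>, \<^const>\<open>infnorm\<close> is the maximum norm.\<close>

definition feasible_dirs ::
  "('d::finite, 'm::finite, 'n::finite) rmdp \<Rightarrow> real \<Rightarrow> real ^ 'n \<Rightarrow> (real ^ 'n) set" where
  "feasible_dirs M \<zeta> \<theta> =
     {r. infnorm r \<le> 1 \<and>
         (\<forall>i. (\<theta> $ i \<ge> box_bound M - \<zeta> \<longrightarrow> r $ i \<le> 0) \<and>
              (\<theta> $ i \<le> - box_bound M + \<zeta> \<longrightarrow> r $ i \<ge> 0))}"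

definition min_slope ::
  "('d::finite, 'm::finite, 'n::finite) rmdp \<Rightarrow> real \<Rightarrow> real ^ 'n \<Rightarrow> real ^ 'n \<Rightarrow> real" where
  "min_slope M \<zeta> \<theta> r = (MIN \<sigma>\<in>near_active M \<zeta> \<theta>. gradient (selection_objective M \<sigma>) \<theta> \<bullet> r)"

text \<open>
  The set of directions is compact and nonempty and \<^const>\<open>min_slope\<close> is continuous in the
  direction, so the supremum below is a maximum.
\<close>

definition ascent_slope ::
  "('d::finite, 'm::finite, 'n::finite) rmdp \<Rightarrow> real \<Rightarrow> real ^ 'n \<Rightarrow> real" where
  "ascent_slope M \<zeta> \<theta> = (SUP r\<in>feasible_dirs M \<zeta> \<theta>. min_slope M \<zeta> \<theta> r)"

definition robust_policy_ascent ::
  "('d::finite, 'm::finite, 'n::finite) rmdp \<Rightarrow> real \<Rightarrow> real \<Rightarrow> real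
     \<Rightarrow> (nat \<Rightarrow> real ^ 'n) \<Rightarrow> (nat \<Rightarrow> real) \<Rightarrow> (nat \<Rightarrow> real ^ 'n) \<Rightarrow> bool" where
  "robust_policy_ascent M C1 C2 \<nu> \<theta> \<zeta> r \<longleftrightarrow>
     \<theta> 0 \<in> param_box M \<and> 0 < \<zeta> 0 \<and> 0 < \<nu> \<and> \<nu> < 1 \<and>
     (\<forall>k. let \<Delta> = ascent_slope M (\<zeta> k) (\<theta> k) in
        is_arg_max (min_slope M (\<zeta> k) (\<theta> k)) (\<lambda>d. d \<in> feasible_dirs M (\<zeta> k) (\<theta> k)) (r k) \<and>
        (if \<Delta> \<le> \<zeta> k
         then \<theta> (Suc k) = \<theta> k \<and> \<zeta> (Suc k) = \<nu> * \<zeta> k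
         else \<theta> (Suc k) = \<theta> k + Min {\<zeta> k, \<zeta> k / C1, \<Delta> / (2 * C2)} *\<^sub>R r k \<and>
              \<zeta> (Suc k) = \<zeta> k))"

definition refinement_iterations ::
  "('d::finite, 'm::finite, 'n::finite) rmdp \<Rightarrow> (nat \<Rightarrow> real ^ 'n) \<Rightarrow> (nat \<Rightarrow> real) \<Rightarrow> nat set" where
  "refinement_iterations M \<theta> \<zeta> = {k. ascent_slope M (\<zeta> k) (\<theta> k) \<le> \<zeta> k}"

end

theory Submission
  imports Defs
begin

text \<open>
  A Wasserstein ball is the image of the compact polytope of transport plans under the first
  marginal. It has finitely many vertices, and a linear function attains its minimum at one of them
  (minimise lexicographically, the coordinates breaking ties). Backward induction then gives
  \<open>J \<le> J\<^sub>\<sigma>\<close> on the box for all selections \<open>\<sigma>\<close>, with equality if all gaps of \<open>\<sigma>\<close> vanish.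

  A selection that is optimal after an ascent step was \<open>\<zeta>\<close>-active before it, because the step length is
  at most \<open>\<zeta> / C1\<close>; so the step increases \<open>J\<close> by at least a fixed multiple of \<open>\<zeta>\<^sup>2\<close>. As \<open>J\<close> is
  bounded, only finitely many consecutive steps can be ascents, hence \<open>\<zeta> \<rightarrow> 0\<close>. At an accumulation
  point of the refinement iterates, the minimising \<open>\<zeta>\<close>-active selections have zero gap, and passing to
  the limit in the second-order bound for them gives \<open>J (\<theta> + h d) \<le> J \<theta> + O(h\<^sup>2)\<close>.
\<close>

section \<open>Vertices of Wasserstein balls on a finite set\<close>

text \<open>The excesses \<open>f a - f x\<close> and \<open>f b - f x\<close> are nonnegative and
  have weighted sum zero, so both vanish. The underlying type carries no linear structure: affinity
  enters only through the equation between the values of \<open>f\<close>.\<close>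

lemma argmin_compact_face:
  fixes f :: "'b::topological_space \<Rightarrow> real"
  assumes "compact K" "K \<noteq> {}" "continuous_on UNIV f"
  defines "K' \<equiv> {x \<in> K. \<forall>y\<in>K. f x \<le> f y}"
  shows "compact K'" "K' \<noteq> {}"
    and "\<And>x a b u. \<lbrakk>x \<in> K'; a \<in> K; b \<in> K; 0 < u; u < 1; f x = (1 - u) * f a + u * f b\<rbrakk>
           \<Longrightarrow> a \<in> K' \<and> b \<in> K'"
proof -
  obtain m where m: "m \<in> K" "\<And>y. y \<in> K \<Longrightarrow> f m \<le> f y"
    using continuous_attains_inf[OF assms(1,2)] continuous_on_subset[OF assms(3)] by blast
  have eq: "K' = K \<inter> {x. f x \<le> f m}"
    using m by (auto simp: K'_def intro: order_trans[of _ "f m"])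
  have "closed {x. f x \<le> f m}"
    using assms(3) by (intro closed_Collect_le) auto
  then show "compact K'"
    unfolding eq using assms(1) by (simp add: compact_Int_closed)
  show "K' \<noteq> {}"
    using m eq by auto
  fix x a b u
  assume *: "x \<in> K'" "a \<in> K" "b \<in> K" "0 < u" "u < 1" "f x = (1 - u) * f a + u * f b"
  have "f x \<le> f a" "f x \<le> f b"
    using * by (auto simp: K'_def)
  have "(1 - u) * (f a - f x) + u * (f b - f x) = 0"
    using *(6) by (simp add: algebra_simps)
  moreover have "0 \<le> (1 - u) * (f a - f x)" "0 \<le> u * (f b - f x)"
    using * \<open>f x \<le> f a\<close> \<open>f x \<le> f b\<close> by simp_all
  ultimately have "(1 - u) * (f a - f x) = 0" "u * (f b - f x) = 0"
    by linarith+
  then have "f a = f x" "f b = f x"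
    using * by auto
  then show "a \<in> K' \<and> b \<in> K'"
    using *(1-3) by (simp add: K'_def)
qed

text \<open>Minimise the functions of the list one after the other, each over the minimisers of its
  predecessors. The face property passes from \<open>L\<close> to \<open>K\<close> because
  \<open>argmin_compact_face\<close> first puts \<open>a\<close> and \<open>b\<close> into
  \<open>L\<close>.\<close>

lemma lexicographic_face:
  fixes fs :: "('b::topological_space \<Rightarrow> real) list"
  assumes "compact K" "K \<noteq> {}" "\<forall>f\<in>set fs. continuous_on UNIV f"
  shows "\<exists>K'. K' \<subseteq> K \<and> K' \<noteq> {} \<and> (\<forall>f\<in>set fs. \<forall>x\<in>K'. \<forall>y\<in>K'. f x = f y) \<and>
           (\<forall>x\<in>K'. \<forall>a\<in>K. \<forall>b\<in>K. \<forall>u. 0 < u \<and> u < 1 \<and>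
              (\<forall>f\<in>set fs. f x = (1 - u) * f a + u * f b) \<longrightarrow> a \<in> K' \<and> b \<in> K')"
  using assms
proof (induction fs arbitrary: K)
  case Nil
  then show ?case by (intro exI[of _ K]) auto
next
  case (Cons f fs)
  define L where "L = {x \<in> K. \<forall>y\<in>K. f x \<le> f y}"
  have cf: "continuous_on UNIV f" and cfs: "\<forall>f\<in>set fs. continuous_on UNIV f"
    using Cons.prems(3) by simp_all
  note face = argmin_compact_face[OF Cons.prems(1,2) cf, folded L_def]
  obtain K' where K': "K' \<subseteq> L" "K' \<noteq> {}" "\<forall>f\<in>set fs. \<forall>x\<in>K'. \<forall>y\<in>K'. f x = f y"
    and ext: "\<forall>x\<in>K'. \<forall>a\<in>L. \<forall>b\<in>L. \<forall>u. 0 < u \<and> u < 1 \<and>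
              (\<forall>f\<in>set fs. f x = (1 - u) * f a + u * f b) \<longrightarrow> a \<in> K' \<and> b \<in> K'"
    using Cons.IH[OF face(1,2) cfs]
    by (elim exE conjE) (rule that)
  have "f x = f y" if "x \<in> K'" "y \<in> K'" for x y
  proof -
    have "x \<in> L" "y \<in> L"
      using that K'(1) by blast+
    then show ?thesis
      by (simp add: L_def antisym)
  qed
  then have const: "\<forall>g\<in>set (f # fs). \<forall>x\<in>K'. \<forall>y\<in>K'. g x = g y"
    using K'(3) by (metis set_ConsD)
  have mid: "a \<in> K' \<and> b \<in> K'"
    if "x \<in> K'" "a \<in> K" "b \<in> K" "0 < u" "u < 1"
      "\<forall>g\<in>set (f # fs). g x = (1 - u) * g a + u * g b" for x a b u
  proof -
    have "a \<in> L \<and> b \<in> L"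
      using face(3)[of x a b u] that K'(1) by auto
    then show ?thesis
      using that by (intro ext[rule_format, of x a b u]) simp_all
  qed
  have "K' \<subseteq> K"
    using K'(1) by (auto simp: L_def)
  moreover have "\<forall>x\<in>K'. \<forall>a\<in>K. \<forall>b\<in>K. \<forall>u. 0 < u \<and> u < 1 \<and>
      (\<forall>g\<in>set (f # fs). g x = (1 - u) * g a + u * g b) \<longrightarrow> a \<in> K' \<and> b \<in> K'"
    by (intro ballI allI impI, elim conjE) (rule mid)
  ultimately show ?case
    using K'(2) const by (intro exI[of _ K'] conjI)
qed

section \<open>Extreme points among PMFs of finite support\<close>

lemma lookup_scaleR:
  fixes p :: "'a \<Rightarrow>\<^sub>0 'b::real_vector"
  shows "poly_mapping.lookup (c *\<^sub>R p) i = c *\<^sub>R poly_mapping.lookup p i"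
proof -
  have "{i. c *\<^sub>R poly_mapping.lookup p i \<noteq> 0} \<subseteq> {i. poly_mapping.lookup p i \<noteq> 0}"
    by auto
  then have "finite {i. c *\<^sub>R poly_mapping.lookup p i \<noteq> 0}"
    by (rule finite_subset) simp
  then show ?thesis
    by (simp add: scaleR_poly_mapping_def Abs_poly_mapping_inverse)
qed

lemma lookup_pmf_vec: "finite (set_pmf p) \<Longrightarrow> poly_mapping.lookup (pmf_vec p) = pmf p"
  by (simp add: pmf_vec_def set_pmf_eq Abs_poly_mapping_inverse)

lemma pmf_vec_eq_convex_combination:
  assumes "finite (set_pmf p)" "finite (set_pmf a)" "finite (set_pmf b)"
  shows "pmf_vec p = (1 - u) *\<^sub>R pmf_vec a + u *\<^sub>R pmf_vec b
           \<longleftrightarrow> (\<forall>x. pmf p x = (1 - u) * pmf a x + u * pmf b x)"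
  using assms by (simp add: poly_mapping_eq_iff fun_eq_iff lookup_add lookup_scaleR lookup_pmf_vec)

lemma pmf_vec_inject:
  assumes "finite (set_pmf p)" "finite (set_pmf p')"
  shows "pmf_vec p = pmf_vec p' \<longleftrightarrow> p = p'"
  by (metis assms lookup_pmf_vec pmf_eqI)

text \<open>Restates extremality in terms of masses alone, the form in which vertices are handled
  below. The conclusion \<open>a = b\<close> reflects that \<open>open_segment\<close> excludes
  coinciding endpoints.\<close>

lemma pmf_vec_extreme_iff:
  assumes "\<And>p. p \<in> S \<Longrightarrow> finite (set_pmf p)" "p \<in> S"
  shows "pmf_vec p extreme_point_of (pmf_vec ` S) \<longleftrightarrow>
    (\<forall>a\<in>S. \<forall>b\<in>S. \<forall>u. 0 < u \<and> u < 1 \<and> (\<forall>x. pmf p x = (1 - u) * pmf a x + u * pmf b x) \<longrightarrow> a = b)"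
proof -
  have *: "pmf_vec p \<notin> open_segment (pmf_vec a) (pmf_vec b) \<longleftrightarrow>
      (\<forall>u. 0 < u \<and> u < 1 \<and> (\<forall>x. pmf p x = (1 - u) * pmf a x + u * pmf b x) \<longrightarrow> a = b)"
    if "a \<in> S" "b \<in> S" for a b
    unfolding in_segment pmf_vec_eq_convex_combination[OF assms(1)[OF assms(2)] assms(1)[OF that(1)] assms(1)[OF that(2)]]
      pmf_vec_inject[OF assms(1)[OF that(1)] assms(1)[OF that(2)]] by meson
  have "pmf_vec p extreme_point_of (pmf_vec ` S) \<longleftrightarrow>
      (\<forall>a\<in>S. \<forall>b\<in>S. pmf_vec p \<notin> open_segment (pmf_vec a) (pmf_vec b))"
    using assms(2) by (simp add: extreme_point_of_def)
  also have "\<dots> \<longleftrightarrow> (\<forall>a\<in>S. \<forall>b\<in>S. \<forall>u. 0 < u \<and> u < 1 \<and>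
      (\<forall>x. pmf p x = (1 - u) * pmf a x + u * pmf b x) \<longrightarrow> a = b)"
    by (intro ball_cong refl *)
  finally show ?thesis .
qed

section \<open>Transport plans and couplings on a finite set\<close>

locale finite_transport =
  fixes X :: "'a::metric_space set" and q :: nat and p0 :: "'a pmf"
  assumes finite_X: "finite X" and q_pos: "1 \<le> q" and supp_p0: "set_pmf p0 \<subseteq> X"
begin

text \<open>Only the second marginal is prescribed; the first one is free and will range over the
  ball. Plans are functions on the whole product type vanishing off \<open>X \<times> X\<close>, so
  that the product topology applies.\<close>

definition plans :: "('a \<times> 'a \<Rightarrow> real) set" where
  "plans = {\<gamma>. (\<forall>z. 0 \<le> \<gamma> z) \<and> (\<forall>z. z \<notin> X \<times> X \<longrightarrow> \<gamma> z = 0) \<and>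
               (\<forall>y\<in>X. (\<Sum>x\<in>X. \<gamma> (x, y)) = pmf p0 y)}"

definition cost :: "('a \<times> 'a \<Rightarrow> real) \<Rightarrow> real" where
  "cost \<gamma> = (\<Sum>(x, y)\<in>X \<times> X. dist x y ^ q * \<gamma> (x, y))"

definition marginal :: "('a \<times> 'a \<Rightarrow> real) \<Rightarrow> 'a \<Rightarrow> real" where
  "marginal \<gamma> x = (\<Sum>y\<in>X. \<gamma> (x, y))"

lemma plans_nonneg: "\<gamma> \<in> plans \<Longrightarrow> 0 \<le> \<gamma> z"
  and plans_outside: "\<gamma> \<in> plans \<Longrightarrow> z \<notin> X \<times> X \<Longrightarrow> \<gamma> z = 0"
  and plans_snd: "\<gamma> \<in> plans \<Longrightarrow> y \<in> X \<Longrightarrow> (\<Sum>x\<in>X. \<gamma> (x, y)) = pmf p0 y"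
  unfolding plans_def by blast+

lemma marginal_outside: "\<gamma> \<in> plans \<Longrightarrow> x \<notin> X \<Longrightarrow> marginal \<gamma> x = 0"
  by (simp add: marginal_def plans_outside)

lemma plans_le_1:
  assumes "\<gamma> \<in> plans"
  shows "\<gamma> z \<le> 1"
proof (cases "z \<in> X \<times> X")
  case True
  then obtain x y where z: "z = (x, y)" "x \<in> X" "y \<in> X" by auto
  have "\<gamma> (x, y) \<le> (\<Sum>x\<in>X. \<gamma> (x, y))"
    using finite_X z assms by (intro member_le_sum) (auto simp: plans_nonneg)
  also have "\<dots> \<le> 1"
    using plans_snd[OF assms] z by (simp add: pmf_le_1)
  finally show ?thesis using z by simp
qed (simp add: plans_outside[OF assms])

text \<open>Plans form a closed subset of a Tychonoff cube: masses lie in \<open>{0..1}\<close> by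
  \<open>plans_le_1\<close>, and each defining condition involves finitely many coordinates.\<close>

lemma compact_plans: "compact plans"
proof -
  have "compactin (product_topology (\<lambda>i. euclidean) UNIV) (PiE UNIV (\<lambda>z::'a \<times> 'a. {0..1::real}))"
    by (simp add: compactin_PiE)
  then have box: "compact (PiE UNIV (\<lambda>z::'a \<times> 'a. {0..1::real}))"
    by (simp add: euclidean_product_topology)
  have plans_eq: "plans = (\<Inter>z. {\<gamma>. 0 \<le> \<gamma> z}) \<inter> (\<Inter>z\<in>- (X \<times> X). {\<gamma>. \<gamma> z = 0})
                  \<inter> (\<Inter>y\<in>X. {\<gamma>. (\<Sum>x\<in>X. \<gamma> (x, y)) = pmf p0 y})"
    by (auto simp: plans_def)
  have "closed plans"
    unfolding plans_eq
    by (intro closed_Int closed_INT ballI closed_Collect_le closed_Collect_eq continuous_intros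
              continuous_on_sum continuous_on_product_coordinates)
  moreover have "plans \<subseteq> PiE UNIV (\<lambda>z. {0..1})"
    by (auto simp: plans_nonneg plans_le_1)
  ultimately show ?thesis
    using compact_Int_closed[OF box, of plans] by (simp add: Int_absorb1)
qed

lemma continuous_cost: "continuous_on UNIV cost"
  unfolding cost_def[abs_def] case_prod_beta
  by (intro continuous_intros continuous_on_sum continuous_on_product_coordinates)

lemma continuous_marginal: "continuous_on UNIV (\<lambda>\<gamma>. marginal \<gamma> x)"
  unfolding marginal_def
  by (intro continuous_intros continuous_on_sum continuous_on_product_coordinates)

lemma cost_combine: "cost (\<lambda>z. a * \<gamma> z + b * \<gamma>' z) = a * cost \<gamma> + b * cost \<gamma>'"
  unfolding cost_def by (simp add: sum_distrib_left sum.distrib case_prod_beta algebra_simps)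

lemma marginal_combine:
  "marginal (\<lambda>z. a * \<gamma> z + b * \<gamma>' z) x = a * marginal \<gamma> x + b * marginal \<gamma>' x"
  unfolding marginal_def by (simp add: sum_distrib_left sum.distrib)

text \<open>One coefficient may be negative, as in the extrapolation with \<open>1 + t\<close> and
  \<open>- t\<close> in \<open>w_vertex_eqI\<close>; hence nonnegativity of the combination is a
  hypothesis.\<close>

lemma plans_combine:
  assumes "\<gamma> \<in> plans" "\<gamma>' \<in> plans" "a + b = 1" "\<And>z. z \<in> X \<times> X \<Longrightarrow> 0 \<le> a * \<gamma> z + b * \<gamma>' z"
  shows "(\<lambda>z. a * \<gamma> z + b * \<gamma>' z) \<in> plans"
proof -
  have "0 \<le> a * \<gamma> z + b * \<gamma>' z" for z
    using assms(4) plans_outside[OF assms(1)] plans_outside[OF assms(2)]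
    by (cases "z \<in> X \<times> X") (blast, simp)
  moreover have "(\<Sum>x\<in>X. a * \<gamma> (x, y) + b * \<gamma>' (x, y)) = pmf p0 y" if "y \<in> X" for y
  proof -
    have "(\<Sum>x\<in>X. a * \<gamma> (x, y) + b * \<gamma>' (x, y)) = (a + b) * pmf p0 y"
      using that assms(1,2)
      by (simp add: sum.distrib flip: sum_distrib_left) (simp add: plans_snd algebra_simps)
    then show ?thesis using assms(3) by simp
  qed
  moreover have "a * \<gamma> z + b * \<gamma>' z = 0" if "z \<notin> X \<times> X" for z
    using plans_outside[OF assms(1) that] plans_outside[OF assms(2) that] by simp
  ultimately show ?thesis
    unfolding plans_def by blast
qed

lemma sum_plan:
  assumes "\<gamma> \<in> plans"
  shows "(\<Sum>z\<in>X \<times> X. \<gamma> z) = 1"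
proof -
  have "(\<Sum>z\<in>X \<times> X. \<gamma> z) = (\<Sum>x\<in>X. \<Sum>y\<in>X. \<gamma> (x, y))"
    by (simp add: sum.cartesian_product)
  also have "\<dots> = (\<Sum>y\<in>X. \<Sum>x\<in>X. \<gamma> (x, y))"
    by (rule sum.swap)
  also have "\<dots> = (\<Sum>y\<in>X. pmf p0 y)"
    using assms by (simp add: plans_snd)
  finally show ?thesis
    using finite_X supp_p0 by (simp add: sum_pmf_eq_1)
qed

lemma expectation_cost:
  assumes "set_pmf \<gamma> \<subseteq> X \<times> X"
  shows "measure_pmf.expectation \<gamma> (\<lambda>(x, y). dist x y ^ q) = cost (pmf \<gamma>)"
  unfolding cost_def using assms finite_X
  by (subst integral_measure_pmf_real[of "X \<times> X"]) (auto intro!: sum.cong)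

lemma pmf_map_fst:
  assumes "set_pmf \<gamma> \<subseteq> X \<times> X"
  shows "pmf (map_pmf fst \<gamma>) x = (\<Sum>y\<in>X. pmf \<gamma> (x, y))"
proof -
  have "pmf (map_pmf fst \<gamma>) x = measure_pmf.prob \<gamma> ((fst -` {x}) \<inter> set_pmf \<gamma>)"
    by (simp only: pmf_map measure_Int_set_pmf)
  also have "(fst -` {x}) \<inter> set_pmf \<gamma> = (Pair x ` X) \<inter> set_pmf \<gamma>"
    using assms by force
  also have "measure_pmf.prob \<gamma> \<dots> = (\<Sum>z\<in>Pair x ` X. pmf \<gamma> z)"
    using finite_X by (simp add: measure_Int_set_pmf measure_measure_pmf_finite)
  finally show ?thesis
    by (simp add: sum.reindex inj_on_def)
qed

lemma pmf_map_snd: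
  assumes "set_pmf \<gamma> \<subseteq> X \<times> X"
  shows "pmf (map_pmf snd \<gamma>) y = (\<Sum>x\<in>X. pmf \<gamma> (x, y))"
proof -
  have "pmf (map_pmf snd \<gamma>) y = measure_pmf.prob \<gamma> ((snd -` {y}) \<inter> set_pmf \<gamma>)"
    by (simp only: pmf_map measure_Int_set_pmf)
  also have "(snd -` {y}) \<inter> set_pmf \<gamma> = ((\<lambda>x. (x, y)) ` X) \<inter> set_pmf \<gamma>"
    using assms by force
  also have "measure_pmf.prob \<gamma> \<dots> = (\<Sum>z\<in>(\<lambda>x. (x, y)) ` X. pmf \<gamma> z)"
    using finite_X by (simp add: measure_Int_set_pmf measure_measure_pmf_finite)
  finally show ?thesis
    by (simp add: sum.reindex inj_on_def)
qed

lemma coupling_support: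
  assumes "\<gamma> \<in> couplings p p0" "set_pmf p \<subseteq> X"
  shows "set_pmf \<gamma> \<subseteq> X \<times> X"
proof -
  have "fst ` set_pmf \<gamma> \<subseteq> X" "snd ` set_pmf \<gamma> \<subseteq> X"
    using assms supp_p0 by (auto simp: couplings_def simp flip: set_map_pmf)
  then show ?thesis by force
qed

lemma coupling_plan:
  assumes "\<gamma> \<in> couplings p p0" "set_pmf p \<subseteq> X"
  shows "pmf \<gamma> \<in> plans" "marginal (pmf \<gamma>) = pmf p"
    and "measure_pmf.expectation \<gamma> (\<lambda>(x, y). dist x y ^ q) = cost (pmf \<gamma>)"
proof -
  note supp = coupling_support[OF assms]
  have maps: "map_pmf fst \<gamma> = p" "map_pmf snd \<gamma> = p0"
    using assms by (auto simp: couplings_def)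
  show "pmf \<gamma> \<in> plans"
    using supp pmf_map_snd[OF supp] maps by (auto simp: plans_def set_pmf_eq)
  show "marginal (pmf \<gamma>) = pmf p"
    using pmf_map_fst[OF supp] maps by (auto simp: marginal_def)
  show "measure_pmf.expectation \<gamma> (\<lambda>(x, y). dist x y ^ q) = cost (pmf \<gamma>)"
    using supp by (rule expectation_cost)
qed

text \<open>Converse of \<open>coupling_plan\<close>: the fixed second marginal gives a plan total
  mass one (\<open>sum_plan\<close>), so it is the mass function of a coupling.\<close>

lemma plan_coupling:
  assumes "\<gamma> \<in> plans"
  obtains p \<pi> where "set_pmf p \<subseteq> X" "pmf p = marginal \<gamma>" "\<pi> \<in> couplings p p0" "pmf \<pi> = \<gamma>"
proof -
  define \<pi> where "\<pi> = embed_pmf \<gamma>"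
  have "(\<integral>\<^sup>+z. ennreal (\<gamma> z) \<partial>count_space UNIV) = (\<Sum>z\<in>X \<times> X. ennreal (\<gamma> z))"
    using finite_X plans_outside[OF assms]
    by (intro nn_integral_count_space'[where A = "X \<times> X"]) auto
  also have "\<dots> = 1"
    using sum_plan[OF assms] plans_nonneg[OF assms] by (simp add: sum_ennreal)
  finally have pmf: "pmf \<pi> = \<gamma>"
    unfolding \<pi>_def using plans_nonneg[OF assms] by (intro ext pmf_embed_pmf)
  have supp: "set_pmf \<pi> \<subseteq> X \<times> X"
    using plans_outside[OF assms] by (auto simp: set_pmf_eq pmf)
  have "pmf (map_pmf snd \<pi>) y = pmf p0 y" for y
  proof (cases "y \<in> X")
    case True
    then show ?thesis
      using pmf_map_snd[OF supp] plans_snd[OF assms] by (simp add: pmf)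
  next
    case False
    then show ?thesis
      using pmf_map_snd[OF supp] plans_outside[OF assms] supp_p0
      by (auto simp: pmf set_pmf_eq)
  qed
  then have "map_pmf snd \<pi> = p0"
    by (rule pmf_eqI)
  moreover have "pmf (map_pmf fst \<pi>) = marginal \<gamma>"
    using pmf_map_fst[OF supp] by (auto simp: marginal_def pmf)
  moreover have "set_pmf (map_pmf fst \<pi>) \<subseteq> X"
    using supp by auto
  ultimately show ?thesis
    using pmf by (intro that[of "map_pmf fst \<pi>" \<pi>]) (auto simp: couplings_def)
qed

text \<open>The infimum in \<open>wasserstein\<close> is attained, since the plans with both
  marginals fixed form a compact set containing the product coupling. The inequality can therefore
  be tested on a single plan, and the ball consists of first marginals of plans within a cost
  budget.\<close>

lemma wasserstein_le_iff:
  assumes "set_pmf p \<subseteq> X" "0 \<le> e"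
  shows "wasserstein q p p0 \<le> e \<longleftrightarrow> (\<exists>\<gamma>\<in>plans. marginal \<gamma> = pmf p \<and> cost \<gamma> \<le> e ^ q)"
proof -
  define C where "C = (\<lambda>\<gamma>. measure_pmf.expectation \<gamma> (\<lambda>(x, y). dist x y ^ q)) ` couplings p p0"
  define L where "L = {\<gamma> \<in> plans. marginal \<gamma> = pmf p}"
  have C_eq: "C = cost ` L"
  proof (intro equalityI subsetI)
    fix c assume "c \<in> C"
    then obtain \<gamma> where "\<gamma> \<in> couplings p p0"
      and "c = measure_pmf.expectation \<gamma> (\<lambda>(x, y). dist x y ^ q)"
      by (auto simp: C_def)
    with coupling_plan[OF _ assms(1), of \<gamma>] show "c \<in> cost ` L"
      by (auto simp: L_def)
  next
    fix c assume "c \<in> cost ` L"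
    then obtain \<gamma> where \<gamma>: "\<gamma> \<in> plans" "marginal \<gamma> = pmf p" "c = cost \<gamma>"
      by (auto simp: L_def)
    obtain p' \<pi> where \<pi>: "set_pmf p' \<subseteq> X" "pmf p' = marginal \<gamma>" "\<pi> \<in> couplings p' p0" "pmf \<pi> = \<gamma>"
      using plan_coupling[OF \<gamma>(1)] .
    have "p' = p"
      using \<pi>(2) \<gamma>(2) by (simp add: pmf_eq_iff)
    then show "c \<in> C"
      using coupling_plan(3)[OF \<pi>(3,1)] \<pi> \<gamma>
      unfolding C_def by (intro image_eqI[where x = \<pi>]) auto
  qed
  have "pair_pmf p p0 \<in> couplings p p0"
    by (simp add: couplings_def map_fst_pair_pmf map_snd_pair_pmf)
  then have "L \<noteq> {}"
    using C_eq by (auto simp: C_def)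
  moreover have "compact L"
  proof -
    have "L = plans \<inter> (\<Inter>x. {\<gamma>. marginal \<gamma> x = pmf p x})"
      by (auto simp: L_def)
    moreover have "closed (\<Inter>x. {\<gamma>. marginal \<gamma> x = pmf p x})"
      by (intro closed_INT ballI closed_Collect_eq continuous_marginal continuous_on_const)
    ultimately show ?thesis
      using compact_plans by (simp add: compact_Int_closed)
  qed
  ultimately obtain m where m: "m \<in> L" "\<And>\<gamma>. \<gamma> \<in> L \<Longrightarrow> cost m \<le> cost \<gamma>"
    using continuous_attains_inf[of L cost] continuous_on_subset[OF continuous_cost] by blast
  then have "Inf C = cost m"
    unfolding C_eq by (intro cInf_eq_minimum) auto
  then have "wasserstein q p p0 = root q (cost m)"
    by (simp add: wasserstein_def C_def)
  moreover have "root q (cost m) \<le> e \<longleftrightarrow> cost m \<le> e ^ q"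
  proof -
    have "root q (cost m) \<le> root q (e ^ q) \<longleftrightarrow> cost m \<le> e ^ q"
      using q_pos by (intro real_root_le_iff) simp
    then show ?thesis
      using q_pos assms(2) by (simp add: real_root_power_cancel)
  qed
  moreover have "cost m \<le> e ^ q \<longleftrightarrow> (\<exists>\<gamma>\<in>L. cost \<gamma> \<le> e ^ q)"
    using m order_trans by blast
  ultimately show ?thesis
    by (auto simp: L_def)
qed

section \<open>Vertices of a Wasserstein ball\<close>

definition w_ball :: "real \<Rightarrow> 'a pmf set" where
  "w_ball e = {p. set_pmf p \<subseteq> X \<and> wasserstein q p p0 \<le> e}"

definition w_vertices :: "real \<Rightarrow> 'a pmf set" where
  "w_vertices e = {p \<in> w_ball e. pmf_vec p extreme_point_of (pmf_vec ` w_ball e)}"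

lemma w_ballD:
  assumes "p \<in> w_ball e" "0 \<le> e"
  obtains \<gamma> where "\<gamma> \<in> plans" "marginal \<gamma> = pmf p" "cost \<gamma> \<le> e ^ q"
  using assms by (auto simp: w_ball_def wasserstein_le_iff)

lemma w_ballI:
  assumes "\<gamma> \<in> plans" "cost \<gamma> \<le> e ^ q" "0 \<le> e"
  obtains p where "p \<in> w_ball e" "pmf p = marginal \<gamma>"
proof -
  obtain p where "set_pmf p \<subseteq> X" "pmf p = marginal \<gamma>"
    using plan_coupling[OF assms(1)] .
  moreover have "wasserstein q p p0 \<le> e"
    unfolding wasserstein_le_iff[OF calculation(1) assms(3)]
    using assms calculation(2) by (intro bexI[of _ \<gamma>]) simp_all
  ultimately show ?thesis
    using that[of p] by (simp add: w_ball_def)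
qed

lemma w_ball_finite_support: "p \<in> w_ball e \<Longrightarrow> finite (set_pmf p)"
  using finite_X by (auto simp: w_ball_def intro: finite_subset)

lemma w_vertices_iff:
  "p \<in> w_vertices e \<longleftrightarrow> p \<in> w_ball e \<and> (\<forall>a\<in>w_ball e. \<forall>b\<in>w_ball e. \<forall>u. 0 < u \<and> u < 1 \<and>
      (\<forall>x. pmf p x = (1 - u) * pmf a x + u * pmf b x) \<longrightarrow> a = b)"
proof (cases "p \<in> w_ball e")
  case True
  have "finite (set_pmf p')" if "p' \<in> w_ball e" for p'
    using that by (rule w_ball_finite_support)
  from pmf_vec_extreme_iff[OF this True] show ?thesis
    unfolding w_vertices_def mem_Collect_eq by (intro conj_cong refl)
next
  case False
  then show ?thesis
    by (simp only: w_vertices_def mem_Collect_eq simp_thms)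
qed

text \<open>If two plans make the same inequalities tight, the segment joining them extends a little
  beyond its endpoints, so the marginals of such plans cannot be distinct vertices.\<close>

lemma w_vertex_eqI:
  assumes p: "p \<in> w_vertices e" and p': "p' \<in> w_ball e" and e: "0 \<le> e"
    and \<gamma>: "\<gamma> \<in> plans" "marginal \<gamma> = pmf p" "cost \<gamma> \<le> e ^ q"
    and \<gamma>': "\<gamma>' \<in> plans" "marginal \<gamma>' = pmf p'" "cost \<gamma>' \<le> e ^ q"
    and supp: "\<And>z. \<gamma> z = 0 \<Longrightarrow> \<gamma>' z = 0"
    and tight: "cost \<gamma> = e ^ q \<Longrightarrow> cost \<gamma>' = e ^ q"
  shows "p = p'"
proof -
  \<comment> \<open>Extrapolate from \<open>\<gamma>'\<close> a little beyond
    \<open>\<gamma>\<close>: coordinates with positive \<open>\<gamma> z\<close> stay positive for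
    small \<open>t\<close>, and the others vanish for both plans by \<open>supp\<close>.\<close>
  have "\<forall>\<^sub>F t in at_right 0. 0 \<le> (1 + t) * \<gamma> z + (- t) * \<gamma>' z" for z
  proof (cases "\<gamma> z = 0")
    case False
    then have "0 < \<gamma> z"
      using plans_nonneg[OF \<gamma>(1), of z] by simp
    moreover have "((\<lambda>t. (1 + t) * \<gamma> z + (- t) * \<gamma>' z) \<longlongrightarrow> (1 + 0) * \<gamma> z + (- 0) * \<gamma>' z) (at_right 0)"
      by (intro tendsto_intros)
    ultimately show ?thesis
      using order_tendstoD(1)[of _ "(1 + 0) * \<gamma> z + (- 0) * \<gamma>' z" _ 0]
      by (force elim: eventually_mono)
  qed (simp add: supp)
  then have "\<forall>\<^sub>F t in at_right 0. \<forall>z\<in>X \<times> X. 0 \<le> (1 + t) * \<gamma> z + (- t) * \<gamma>' z"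
    using finite_X by (intro eventually_ball_finite) auto
  \<comment> \<open>A slack budget stays slack for small \<open>t\<close>; a tight one is met
    exactly, because both costs then equal \<open>e ^ q\<close>.\<close>
  moreover have "\<forall>\<^sub>F t in at_right 0. (1 + t) * cost \<gamma> + (- t) * cost \<gamma>' \<le> e ^ q"
  proof (cases "cost \<gamma> = e ^ q")
    case False
    have "((\<lambda>t. (1 + t) * cost \<gamma> + (- t) * cost \<gamma>') \<longlongrightarrow> (1 + 0) * cost \<gamma> + (- 0) * cost \<gamma>') (at_right 0)"
      by (intro tendsto_intros)
    moreover have "cost \<gamma> < e ^ q"
      using False \<gamma>(3) by simp
    ultimately show ?thesis
      using order_tendstoD(2)[of _ "(1 + 0) * cost \<gamma> + (- 0) * cost \<gamma>'" _ "e ^ q"]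
      by (force elim: eventually_mono)
  qed (simp add: tight algebra_simps)
  moreover have "\<forall>\<^sub>F t in at_right (0::real). 0 < t"
    by (simp add: eventually_at_right_less)
  ultimately have "\<forall>\<^sub>F t in at_right 0. 0 < t \<and> (1 + t) * cost \<gamma> + (- t) * cost \<gamma>' \<le> e ^ q \<and>
      (\<forall>z\<in>X \<times> X. 0 \<le> (1 + t) * \<gamma> z + (- t) * \<gamma>' z)"
    by eventually_elim auto
  then obtain t where t: "0 < t" "(1 + t) * cost \<gamma> + (- t) * cost \<gamma>' \<le> e ^ q"
      "\<forall>z\<in>X \<times> X. 0 \<le> (1 + t) * \<gamma> z + (- t) * \<gamma>' z"
    using eventually_happens'[OF trivial_limit_at_right_real] by blast
  have "(\<lambda>z. (1 + t) * \<gamma> z + (- t) * \<gamma>' z) \<in> plans"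
    using t \<gamma> \<gamma>' by (intro plans_combine) auto
  then obtain s where s: "s \<in> w_ball e" "pmf s = marginal (\<lambda>z. (1 + t) * \<gamma> z + (- t) * \<gamma>' z)"
    using w_ballI[of "\<lambda>z. (1 + t) * \<gamma> z + (- t) * \<gamma>' z" e] t(2) e cost_combine[of "1 + t" \<gamma> "- t" \<gamma>']
    by metis
  have s': "pmf s x = (1 + t) * pmf p x + (- t) * pmf p' x" for x
    unfolding s(2) marginal_combine \<gamma>(2) \<gamma>'(2) ..
  \<comment> \<open>The weight that comes from solving \<open>s = (1 + t) p - t p'\<close> for
    \<open>p\<close>. Extremality of \<open>p\<close> then forces \<open>s = p'\<close>, and the
    same equation yields \<open>p = p'\<close>.\<close>
  define u where "u = t / (1 + t)"
  have u: "0 < u" "u < 1"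
    using t by (auto simp: u_def)
  have "pmf p x = (1 - u) * pmf s x + u * pmf p' x" for x
  proof -
    have "1 - u = 1 / (1 + t)"
      using t(1) by (simp add: u_def field_simps)
    then show ?thesis
      using t(1) unfolding s' \<open>1 - u = 1 / (1 + t)\<close> u_def
      by (simp add: divide_simps)
  qed
  then have "s = p'"
    using p s(1) p' u unfolding w_vertices_iff by blast
  then have "(1 + t) * pmf p x = (1 + t) * pmf p' x" for x
    using s'[of x] by (simp add: algebra_simps)
  then show ?thesis
    using t(1) by (intro pmf_eqI) simp
qed

text \<open>By \<open>w_vertex_eqI\<close>, a vertex is determined by the support of a plan chosen
  for it and by whether that plan exhausts the budget. There are only finitely many such
  patterns.\<close>

lemma finite_w_vertices:
  assumes "0 \<le> e"
  shows "finite (w_vertices e)"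
proof -
  have "\<forall>p\<in>w_vertices e. \<exists>\<gamma>\<in>plans. marginal \<gamma> = pmf p \<and> cost \<gamma> \<le> e ^ q"
    using assms by (auto simp: w_vertices_iff elim!: w_ballD)
  then obtain g where g: "\<And>p. p \<in> w_vertices e \<Longrightarrow> g p \<in> plans \<and> marginal (g p) = pmf p \<and> cost (g p) \<le> e ^ q"
    by metis
  define active where "active p = ({z. g p z \<noteq> 0}, cost (g p) = e ^ q)" for p
  have "inj_on active (w_vertices e)"
  proof (rule inj_onI)
    fix p p' assume *: "p \<in> w_vertices e" "p' \<in> w_vertices e" "active p = active p'"
    then have "p' \<in> w_ball e"
      by (simp add: w_vertices_iff)
    moreover have "g p' z = 0" if "g p z = 0" for z
      using *(3) that unfolding active_def by blast
    moreover have "cost (g p') = e ^ q" if "cost (g p) = e ^ q"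
      using *(3) that unfolding active_def by blast
    ultimately show "p = p'"
      using g[OF *(1)] g[OF *(2)]
      by (elim conjE) (rule w_vertex_eqI[where \<gamma> = "g p" and \<gamma>' = "g p'", OF *(1) _ assms])
  qed
  moreover have "active ` w_vertices e \<subseteq> Pow (X \<times> X) \<times> UNIV"
    using g plans_outside by (fastforce simp: active_def)
  then have "finite (active ` w_vertices e)"
    by (rule finite_subset) (simp add: finite_X)
  ultimately show ?thesis
    by (metis finite_imageD)
qed

text \<open>Minimise the linear function over the plans within budget, then break ties by the
  coordinates of the marginal. The surviving plans share one marginal, and the face property makes
  it extreme in the ball.\<close>

lemma linear_min_at_w_vertex:
  assumes "0 \<le> e"
  shows "\<exists>p\<in>w_vertices e. \<forall>p'\<in>w_ball e. (\<Sum>y\<in>X. pmf p y * \<phi> y) \<le> (\<Sum>y\<in>X. pmf p' y * \<phi> y)"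
proof -
  define K where "K = {\<gamma> \<in> plans. cost \<gamma> \<le> e ^ q}"
  have "K = plans \<inter> {\<gamma>. cost \<gamma> \<le> e ^ q}"
    by (auto simp: K_def)
  then have "compact K"
    using compact_plans closed_Collect_le[OF continuous_cost continuous_on_const]
    by (simp add: compact_Int_closed)
  have "K \<noteq> {}"
  proof -
    \<comment> \<open>The diagonal coupling leaves all mass in place, so its cost is zero and fits
      every budget.\<close>
    have c: "map_pmf (\<lambda>x. (x, x)) p0 \<in> couplings p0 p0"
      by (simp add: couplings_def pmf.map_comp o_def)
    have "measure_pmf.expectation (map_pmf (\<lambda>x. (x, x)) p0) (\<lambda>(x, y). dist x y ^ q) = 0"
      using q_pos by simp
    then have "pmf (map_pmf (\<lambda>x. (x, x)) p0) \<in> K"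
      using coupling_plan[OF c supp_p0] assms q_pos by (simp add: K_def power_0_left)
    then show ?thesis by blast
  qed
  define \<Phi> where "\<Phi> \<gamma> = (\<Sum>y\<in>X. marginal \<gamma> y * \<phi> y)" for \<gamma>
  have "continuous_on UNIV \<Phi>"
    unfolding \<Phi>_def by (intro continuous_intros continuous_on_sum continuous_marginal)
  define L where "L = {x \<in> K. \<forall>y\<in>K. \<Phi> x \<le> \<Phi> y}"
  note face = argmin_compact_face[OF \<open>compact K\<close> \<open>K \<noteq> {}\<close> \<open>continuous_on UNIV \<Phi>\<close>, folded L_def]
  obtain xs where xs: "set xs = X"
    using finite_X finite_list by blast
  define fs where "fs = map (\<lambda>x \<gamma>. marginal \<gamma> x) xs"
  have fs: "set fs = (\<lambda>x \<gamma>. marginal \<gamma> x) ` X"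
    by (simp add: fs_def xs)
  have "\<forall>f\<in>set fs. continuous_on UNIV f"
    using continuous_marginal by (auto simp: fs)
  from lexicographic_face[OF face(1,2) this]
  obtain K' where K': "K' \<subseteq> L" "K' \<noteq> {}" "\<forall>f\<in>set fs. \<forall>\<gamma>\<in>K'. \<forall>\<gamma>'\<in>K'. f \<gamma> = f \<gamma>'"
    and ext: "\<forall>\<gamma>\<in>K'. \<forall>a\<in>L. \<forall>b\<in>L. \<forall>u. 0 < u \<and> u < 1 \<and>
       (\<forall>f\<in>set fs. f \<gamma> = (1 - u) * f a + u * f b) \<longrightarrow> a \<in> K' \<and> b \<in> K'"
    by (elim exE conjE) (rule that)
  obtain \<gamma> where \<gamma>: "\<gamma> \<in> K'"
    using K' by blast
  then have "\<gamma> \<in> plans" "cost \<gamma> \<le> e ^ q"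
    using K' by (auto simp: L_def K_def)
  then obtain p where p: "p \<in> w_ball e" "pmf p = marginal \<gamma>"
    using w_ballI assms by metis
  \<comment> \<open>Plans lifting \<open>a\<close> and \<open>b\<close> need not combine to
    \<open>\<gamma>\<close>; only their marginals combine to that of \<open>\<gamma>\<close>. This
    suffices, since \<open>\<Phi>\<close> and all members of \<open>fs\<close> depend on the
    marginal alone.\<close>
  have "a = b" if ab: "a \<in> w_ball e" "b \<in> w_ball e" "0 < u" "u < 1"
      "\<forall>x. pmf p x = (1 - u) * pmf a x + u * pmf b x" for a b u
  proof -
    obtain \<alpha> where \<alpha>: "\<alpha> \<in> K" "marginal \<alpha> = pmf a"
      using w_ballD[OF ab(1) assms] by (auto simp: K_def)
    obtain \<beta> where \<beta>: "\<beta> \<in> K" "marginal \<beta> = pmf b"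
      using w_ballD[OF ab(2) assms] by (auto simp: K_def)
    have m: "marginal \<gamma> x = (1 - u) * marginal \<alpha> x + u * marginal \<beta> x" for x
      using ab(5) p \<alpha> \<beta> by simp
    have "\<Phi> \<gamma> = (1 - u) * \<Phi> \<alpha> + u * \<Phi> \<beta>"
      unfolding \<Phi>_def m sum_distrib_left sum.distrib[symmetric]
      by (intro sum.cong) (auto simp: algebra_simps)
    then have "\<alpha> \<in> L" "\<beta> \<in> L"
      using face(3)[of \<gamma> \<alpha> \<beta> u] \<gamma> K'(1) \<alpha> \<beta> ab by auto
    moreover have "\<forall>f\<in>set fs. f \<gamma> = (1 - u) * f \<alpha> + u * f \<beta>"
      unfolding fs using m by blast
    ultimately have "\<alpha> \<in> K'" "\<beta> \<in> K'"
      using ext \<gamma> ab(3,4) by blast+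
    then have "marginal \<alpha> x = marginal \<beta> x" for x
    proof (cases "x \<in> X")
      case True
      then show ?thesis
        using bspec[OF K'(3)[unfolded fs] imageI[OF True]] \<open>\<alpha> \<in> K'\<close> \<open>\<beta> \<in> K'\<close> by blast
    next
      case False
      have "\<alpha> \<in> plans" "\<beta> \<in> plans"
        using \<alpha>(1) \<beta>(1) by (simp_all add: K_def)
      then show ?thesis
        using False marginal_outside by metis
    qed
    then show "a = b"
      using \<alpha> \<beta> by (metis pmf_eqI)
  qed
  then have "p \<in> w_vertices e"
    using p by (auto simp: w_vertices_iff)
  moreover have "(\<Sum>y\<in>X. pmf p y * \<phi> y) \<le> (\<Sum>y\<in>X. pmf p' y * \<phi> y)" if "p' \<in> w_ball e" for p'
  proof -
    obtain \<gamma>' where "\<gamma>' \<in> K" "marginal \<gamma>' = pmf p'"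
      using w_ballD[OF \<open>p' \<in> w_ball e\<close> assms] by (auto simp: K_def)
    then have "\<Phi> \<gamma> \<le> \<Phi> \<gamma>'"
      using \<gamma> K'(1) by (auto simp: L_def)
    then show ?thesis
      using p \<open>marginal \<gamma>' = pmf p'\<close> by (simp add: \<Phi>_def)
  qed
  ultimately show ?thesis
    by (intro bexI[of _ p] ballI)
qed

end

section \<open>Robust values and vertex selections\<close>

lemma finite_robust_mdpD:
  assumes "finite_robust_mdp M"
  shows "finite (states M)" "finite (actions M)" "1 \<le> worder M" "0 < radius M" "0 < box_bound M"
    and "\<lbrakk>t < horizon M; x \<in> states M; a \<in> actions M\<rbrakk> \<Longrightarrow> set_pmf (nominal M t x a) \<subseteq> states M"
    and "\<lbrakk>t < horizon M; \<eta> \<in> param_box M; x \<in> states M; a \<in> actions M\<rbrakk> \<Longrightarrow> 0 \<le> policy M t \<eta> x a"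
  using assms unfolding finite_robust_mdp_def by blast+

lemma ambiguity_ball_transport:
  assumes "finite_robust_mdp M" "t < horizon M" "x \<in> states M" "a \<in> actions M"
  shows "finite_transport (states M) (worder M) (nominal M t x a)"
    and "ambiguity_ball M t x a =
           finite_transport.w_ball (states M) (worder M) (nominal M t x a) (radius M)"
    and "ball_vertices M t x a =
           finite_transport.w_vertices (states M) (worder M) (nominal M t x a) (radius M)"
proof -
  interpret finite_transport "states M" "worder M" "nominal M t x a"
    using finite_robust_mdpD(1,3,6)[OF assms(1)] assms(2-4) by unfold_locales
  show "finite_transport (states M) (worder M) (nominal M t x a)"
    by (rule finite_transport_axioms)
  show ball: "ambiguity_ball M t x a = w_ball (radius M)"
    by (simp only: ambiguity_ball_def w_ball_def)
  show "ball_vertices M t x a = w_vertices (radius M)"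
    by (simp only: ball_vertices_def w_vertices_def ball)
qed

lemma finite_ball_vertices:
  assumes "finite_robust_mdp M" "t < horizon M" "x \<in> states M" "a \<in> actions M"
  shows "finite (ball_vertices M t x a)"
  using finite_transport.finite_w_vertices[OF ambiguity_ball_transport(1)[OF assms]]
    ambiguity_ball_transport(3)[OF assms] finite_robust_mdpD(4)[OF assms(1)] by simp

lemma pairing_min_at_vertex:
  assumes "finite_robust_mdp M" "t < horizon M" "x \<in> states M" "a \<in> actions M"
  shows "\<exists>P\<in>ball_vertices M t x a. \<forall>P'\<in>ambiguity_ball M t x a. pairing M P \<phi> \<le> pairing M P' \<phi>"
proof -
  note tr = ambiguity_ball_transport[OF assms]
  have "0 \<le> radius M"
    using finite_robust_mdpD(4)[OF assms(1)] by simp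
  then show ?thesis
    unfolding tr(2,3) pairing_def by (rule finite_transport.linear_min_at_w_vertex[OF tr(1)])
qed

lemma ball_vertices_subset: "ball_vertices M t x a \<subseteq> ambiguity_ball M t x a"
  by (auto simp: ball_vertices_def)

text \<open>The infimum over the whole ball is the value at some vertex, so passing to vertex
  selections loses nothing.\<close>

lemma robust_min_at_vertex:
  assumes "finite_robust_mdp M" "t < horizon M" "x \<in> states M" "a \<in> actions M"
  obtains P where "P \<in> ball_vertices M t x a"
    and "robust_min M t x a v = pairing M P (\<lambda>y. reward M t x a y + v y)"
    and "\<And>P'. P' \<in> ambiguity_ball M t x a \<Longrightarrow>
           robust_min M t x a v \<le> pairing M P' (\<lambda>y. reward M t x a y + v y)"
proof -
  obtain P where P: "P \<in> ball_vertices M t x a" and min: "\<forall>P'\<in>ambiguity_ball M t x a.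
      pairing M P (\<lambda>y. reward M t x a y + v y) \<le> pairing M P' (\<lambda>y. reward M t x a y + v y)"
    using pairing_min_at_vertex[OF assms, where \<phi> = "\<lambda>y. reward M t x a y + v y"] by blast
  have "robust_min M t x a v = pairing M P (\<lambda>y. reward M t x a y + v y)"
    unfolding robust_min_def
  proof (rule cInf_eq_minimum)
    have "P \<in> ambiguity_ball M t x a"
      using P ball_vertices_subset by blast
    then show "pairing M P (\<lambda>y. reward M t x a y + v y)
        \<in> (\<lambda>P. pairing M P (\<lambda>y. reward M t x a y + v y)) ` ambiguity_ball M t x a"
      by (rule imageI)
  qed (use min in \<open>elim imageE, simp\<close>)
  then show ?thesis
    using that P min by metis
qed

lemma robust_min_le_pairing:
  assumes "finite_robust_mdp M" "t < horizon M" "x \<in> states M" "a \<in> actions M"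
    and "P \<in> ball_vertices M t x a"
  shows "robust_min M t x a v \<le> pairing M P (\<lambda>y. reward M t x a y + v y)"
proof -
  have "P \<in> ambiguity_ball M t x a"
    using assms(5) ball_vertices_subset by blast
  then show ?thesis
    using robust_min_at_vertex[OF assms(1-4), of v] by metis
qed

lemma pairing_mono:
  assumes "\<And>y. y \<in> states M \<Longrightarrow> \<phi> y \<le> \<psi> y"
  shows "pairing M P \<phi> \<le> pairing M P \<psi>"
  unfolding pairing_def using assms by (intro sum_mono mult_left_mono) simp_all

lemma finite_selections:
  assumes "finite_robust_mdp M"
  shows "finite (selections M)"
  unfolding selections_def
  using finite_robust_mdpD(1,2)[OF assms] finite_ball_vertices[OF assms]
  by (intro finite_PiE) auto

lemma selection_vertex:
  assumes "\<sigma> \<in> selections M" "t < horizon M" "x \<in> states M" "a \<in> actions M"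
  shows "\<sigma> (t, x, a) \<in> ball_vertices M t x a"
  using PiE_mem[OF assms(1)[unfolded selections_def], of "(t, x, a)"] assms(2-4) by simp

section \<open>The robust objective as lower envelope of the selection objectives\<close>

text \<open>Backward induction: the robust minimum is at most the pairing with the vertex picked by
  \<open>\<sigma>\<close>, and a larger continuation value only increases the latter. Averaging over
  actions keeps the order because policy weights are nonnegative on the box.\<close>

lemma robust_value_le_selection_value:
  assumes mdp: "finite_robust_mdp M" and \<sigma>: "\<sigma> \<in> selections M" and \<eta>: "\<eta> \<in> param_box M"
    and "t \<le> horizon M"
  shows "\<forall>x\<in>states M. robust_value M \<eta> t x \<le> selection_value M \<sigma> \<eta> t x"
  using \<open>t \<le> horizon M\<close>
proof (induction rule: inc_induct)
  case base
  show ?case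
    by (simp add: robust_value.simps selection_value.simps)
next
  case (step t)
  show ?case
  proof
    fix x assume x: "x \<in> states M"
    have "robust_min M t x a (robust_value M \<eta> (Suc t))
        \<le> pairing M (\<sigma> (t, x, a)) (\<lambda>y. reward M t x a y + selection_value M \<sigma> \<eta> (Suc t) y)"
      if a: "a \<in> actions M" for a
    proof -
      have "robust_min M t x a (robust_value M \<eta> (Suc t))
          \<le> pairing M (\<sigma> (t, x, a)) (\<lambda>y. reward M t x a y + robust_value M \<eta> (Suc t) y)"
        using step.hyps x a selection_vertex[OF \<sigma>] by (intro robust_min_le_pairing[OF mdp])
      also have "\<dots> \<le> pairing M (\<sigma> (t, x, a)) (\<lambda>y. reward M t x a y + selection_value M \<sigma> \<eta> (Suc t) y)"
        using step.IH by (intro pairing_mono) simp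
      finally show ?thesis .
    qed
    then show "robust_value M \<eta> t x \<le> selection_value M \<sigma> \<eta> t x"
      unfolding robust_value.simps[of M \<eta> t] selection_value.simps[of M \<sigma> \<eta> t]
      using step.hyps x finite_robust_mdpD(7)[OF mdp _ \<eta>]
      by (auto intro!: sum_mono mult_left_mono)
  qed
qed

text \<open>A gap measures \<open>\<sigma>\<close> against the robust continuation value, not
  against the value of \<open>\<sigma>\<close> itself; the induction hypothesis for
  \<open>Suc t\<close> bridges the two.\<close>

lemma selection_value_le_robust_value:
  assumes mdp: "finite_robust_mdp M" and \<eta>: "\<eta> \<in> param_box M" and "t \<le> horizon M"
    and gap: "\<And>t x a. \<lbrakk>t < horizon M; x \<in> states M; a \<in> actions M\<rbrakk> \<Longrightarrow> gap M \<sigma> \<eta> t x a \<le> 0"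
  shows "\<forall>x\<in>states M. selection_value M \<sigma> \<eta> t x \<le> robust_value M \<eta> t x"
  using \<open>t \<le> horizon M\<close>
proof (induction rule: inc_induct)
  case base
  show ?case
    by (simp add: robust_value.simps selection_value.simps)
next
  case (step t)
  show ?case
  proof
    fix x assume x: "x \<in> states M"
    have "pairing M (\<sigma> (t, x, a)) (\<lambda>y. reward M t x a y + selection_value M \<sigma> \<eta> (Suc t) y)
        \<le> robust_min M t x a (robust_value M \<eta> (Suc t))"
      if a: "a \<in> actions M" for a
    proof -
      have "pairing M (\<sigma> (t, x, a)) (\<lambda>y. reward M t x a y + selection_value M \<sigma> \<eta> (Suc t) y)
          \<le> pairing M (\<sigma> (t, x, a)) (\<lambda>y. reward M t x a y + robust_value M \<eta> (Suc t) y)"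
        using step.IH by (intro pairing_mono) simp
      also have "\<dots> \<le> robust_min M t x a (robust_value M \<eta> (Suc t))"
        using gap[OF step.hyps(2) x a] by (simp add: gap_def robust_q_def)
      finally show ?thesis .
    qed
    then show "selection_value M \<sigma> \<eta> t x \<le> robust_value M \<eta> t x"
      unfolding robust_value.simps[of M \<eta> t] selection_value.simps[of M \<sigma> \<eta> t]
      using step.hyps x finite_robust_mdpD(7)[OF mdp _ \<eta>]
      by (auto intro!: sum_mono mult_left_mono)
  qed
qed

lemma robust_objective_le:
  assumes "finite_robust_mdp M" "\<sigma> \<in> selections M" "\<eta> \<in> param_box M"
  shows "robust_objective M \<eta> \<le> selection_objective M \<sigma> \<eta>"
  unfolding robust_objective_def selection_objective_def
  using robust_value_le_selection_value[OF assms, of 0] by (intro sum_mono mult_left_mono) auto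

lemma near_active_selection: "\<sigma> \<in> near_active M z \<eta> \<Longrightarrow> \<sigma> \<in> selections M"
  by (simp add: near_active_def)

lemma near_active_mono: "z \<le> z' \<Longrightarrow> near_active M z \<eta> \<subseteq> near_active M z' \<eta>"
  unfolding near_active_def by (blast intro: order_trans)

text \<open>With \<open>robust_objective_le\<close>, this shows that selections without gap touch
  the lower envelope at \<open>\<eta>\<close>.\<close>

lemma near_active_0_objective:
  assumes "finite_robust_mdp M" "\<sigma> \<in> near_active M 0 \<eta>" "\<eta> \<in> param_box M"
  shows "selection_objective M \<sigma> \<eta> = robust_objective M \<eta>"
proof (rule antisym)
  have "\<forall>x\<in>states M. selection_value M \<sigma> \<eta> 0 x \<le> robust_value M \<eta> 0 x"
    using assms(2) by (intro selection_value_le_robust_value assms(1,3)) (auto simp: near_active_def)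
  then show "selection_objective M \<sigma> \<eta> \<le> robust_objective M \<eta>"
    unfolding robust_objective_def selection_objective_def by (intro sum_mono mult_left_mono) auto
qed (use assms near_active_selection robust_objective_le in blast)

text \<open>Choose at every \<open>(t, x, a)\<close> a vertex that attains the minimum against the
  robust continuation value. This also ensures that the minimum in \<open>min_slope\<close> runs
  over a nonempty set for every nonnegative tolerance.\<close>

lemma near_active_0_nonempty:
  assumes "finite_robust_mdp M"
  shows "near_active M 0 \<eta> \<noteq> {}"
proof -
  have "\<forall>k\<in>{..<horizon M} \<times> states M \<times> actions M. \<exists>P. case k of (t, x, a) \<Rightarrow>
      P \<in> ball_vertices M t x a \<and> robust_min M t x a (robust_value M \<eta> (Suc t)) =
        pairing M P (\<lambda>y. reward M t x a y + robust_value M \<eta> (Suc t) y)"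
    using robust_min_at_vertex[OF assms] by (auto split: prod.split) metis
  then obtain s where s: "\<And>t x a. \<lbrakk>t < horizon M; x \<in> states M; a \<in> actions M\<rbrakk> \<Longrightarrow>
      s (t, x, a) \<in> ball_vertices M t x a \<and> robust_min M t x a (robust_value M \<eta> (Suc t)) =
        pairing M (s (t, x, a)) (\<lambda>y. reward M t x a y + robust_value M \<eta> (Suc t) y)"
    by (auto simp: bchoice_iff)
  define \<sigma> where "\<sigma> = restrict s ({..<horizon M} \<times> states M \<times> actions M)"
  have "\<sigma> \<in> selections M"
    unfolding selections_def \<sigma>_def using s by (intro restrict_PiE_iff[THEN iffD2]) auto
  moreover have "gap M \<sigma> \<eta> t x a = 0" if "t < horizon M" "x \<in> states M" "a \<in> actions M" for t x a
    using s[OF that] that by (simp add: \<sigma>_def gap_def robust_q_def)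
  ultimately have "\<sigma> \<in> near_active M 0 \<eta>"
    by (simp add: near_active_def)
  then show ?thesis
    by blast
qed

text \<open>A selection that is not exactly active has some positive gap and drops out once
  \<open>z\<close> is below it. As there are finitely many selections, approximate activity at small
  tolerance becomes exact activity.\<close>

lemma near_active_eventually_0:
  assumes "finite_robust_mdp M"
  shows "\<forall>\<^sub>F z in at_right 0. near_active M z \<eta> \<subseteq> near_active M 0 \<eta>"
proof -
  have "\<forall>\<^sub>F z in at_right 0. \<sigma> \<in> near_active M z \<eta> \<longrightarrow> \<sigma> \<in> near_active M 0 \<eta>"
    if \<sigma>: "\<sigma> \<in> selections M" for \<sigma>
  proof (cases "\<sigma> \<in> near_active M 0 \<eta>")
    case False
    then obtain t x a where *: "t < horizon M" "x \<in> states M" "a \<in> actions M" "gap M \<sigma> \<eta> t x a > 0"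
      using \<sigma> by (auto simp: near_active_def not_le)
    have "\<forall>\<^sub>F z in at_right 0. z < gap M \<sigma> \<eta> t x a"
      using *(4) by (intro eventually_at_right_field[THEN iffD2]) blast
    then show ?thesis
      by eventually_elim (use * in \<open>force simp: near_active_def\<close>)
  qed simp
  then have "\<forall>\<^sub>F z in at_right 0. \<forall>\<sigma>\<in>selections M. \<sigma> \<in> near_active M z \<eta> \<longrightarrow> \<sigma> \<in> near_active M 0 \<eta>"
    using finite_selections[OF assms] by (intro eventually_ball_finite) auto
  then show ?thesis
    by eventually_elim (auto dest: near_active_selection)
qed

lemma finite_near_active: "finite_robust_mdp M \<Longrightarrow> finite (near_active M z \<eta>)"
  by (rule finite_subset[OF _ finite_selections]) (auto dest: near_active_selection)

lemma min_slope_le: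
  assumes "finite_robust_mdp M" "\<sigma> \<in> near_active M z \<eta>"
  shows "min_slope M z \<eta> d \<le> gradient (selection_objective M \<sigma>) \<eta> \<bullet> d"
  unfolding min_slope_def using assms finite_near_active by (intro Min_le) auto

lemma min_slope_attained:
  assumes "finite_robust_mdp M" "0 \<le> z"
  obtains \<sigma> where "\<sigma> \<in> near_active M z \<eta>"
    and "gradient (selection_objective M \<sigma>) \<eta> \<bullet> d = min_slope M z \<eta> d"
proof -
  have "near_active M z \<eta> \<noteq> {}"
    using near_active_0_nonempty[OF assms(1)] near_active_mono[OF assms(2)] by blast
  then have "min_slope M z \<eta> d \<in> (\<lambda>\<sigma>. gradient (selection_objective M \<sigma>) \<eta> \<bullet> d) ` near_active M z \<eta>"
    unfolding min_slope_def using finite_near_active[OF assms(1)] by (intro Min_in) auto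
  then show ?thesis
    using that by auto
qed

section \<open>Feasible steps in the parameter box\<close>

text \<open>No coordinate moves by more than \<open>z\<close>, and one within \<open>z\<close> of a
  bound does not move towards it. This is the purpose of the cap \<open>\<zeta> k\<close> on the
  step length.\<close>

lemma param_box_add_feasible:
  assumes "\<eta> \<in> param_box M" "d \<in> feasible_dirs M z \<eta>" "0 \<le> h" "h \<le> z"
  shows "\<eta> + h *\<^sub>R d \<in> param_box M"
proof -
  have "- box_bound M \<le> (\<eta> + h *\<^sub>R d) $ i \<and> (\<eta> + h *\<^sub>R d) $ i \<le> box_bound M" for i
  proof -
    have b: "- box_bound M \<le> \<eta> $ i" "\<eta> $ i \<le> box_bound M"
      using assms(1) by (auto simp: param_box_def)
    have "\<bar>d $ i\<bar> \<le> 1"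
      using component_le_infnorm_cart[of d i] assms(2) by (auto simp: feasible_dirs_def)
    then have hd: "\<bar>h * d $ i\<bar> \<le> z"
      using assms(3,4) mult_left_le[of "\<bar>d $ i\<bar>" h] by (simp add: abs_mult)
    have "h * d $ i \<le> 0" if "\<eta> $ i \<ge> box_bound M - z"
      using assms(2,3) that by (auto simp: feasible_dirs_def mult_nonneg_nonpos)
    moreover have "0 \<le> h * d $ i" if "\<eta> $ i \<le> - box_bound M + z"
      using assms(2,3) that by (auto simp: feasible_dirs_def)
    ultimately show ?thesis
      using b hd by (simp add: abs_le_iff) linarith
  qed
  then show ?thesis
    by (simp add: param_box_def)
qed

lemma closed_param_box: "closed (param_box M)"
proof -
  have "param_box M = (\<Inter>i. {\<eta>. - box_bound M \<le> \<eta> $ i} \<inter> {\<eta>. \<eta> $ i \<le> box_bound M})"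
    by (auto simp: param_box_def)
  then show ?thesis
    by (auto intro!: closed_INT closed_Int closed_Collect_le continuous_intros)
qed

text \<open>A coordinate that moves towards a bound does not lie on it, so strict inequality
  persists for short steps. Strictness matters: it also survives a small change of the base point,
  as \<open>limit_of_refinements\<close> requires.\<close>

lemma feasible_dirs_0_interior:
  assumes "\<eta> \<in> param_box M" "d \<in> feasible_dirs M 0 \<eta>"
  shows "\<forall>\<^sub>F h in at_right 0. \<forall>i. (0 < d $ i \<longrightarrow> \<eta> $ i + h * d $ i < box_bound M) \<and>
           (d $ i < 0 \<longrightarrow> - box_bound M < \<eta> $ i + h * d $ i)"
proof (intro eventually_all_finite eventually_conj)
  fix i
  have lim: "((\<lambda>h. \<eta> $ i + h * d $ i) \<longlongrightarrow> \<eta> $ i + 0 * d $ i) (at_right 0)"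
    by (intro tendsto_intros)
  show "\<forall>\<^sub>F h in at_right 0. 0 < d $ i \<longrightarrow> \<eta> $ i + h * d $ i < box_bound M"
  proof (cases "0 < d $ i")
    case True
    have "box_bound M \<le> \<eta> $ i \<Longrightarrow> d $ i \<le> 0"
      using assms(2) by (simp add: feasible_dirs_def)
    with True have "\<eta> $ i < box_bound M"
      by linarith
    then show ?thesis
      using order_tendstoD(2)[OF lim, of "box_bound M"] by (auto elim: eventually_mono)
  qed simp
  show "\<forall>\<^sub>F h in at_right 0. d $ i < 0 \<longrightarrow> - box_bound M < \<eta> $ i + h * d $ i"
  proof (cases "d $ i < 0")
    case True
    have "\<eta> $ i \<le> - box_bound M \<Longrightarrow> 0 \<le> d $ i"
      using assms(2) by (simp add: feasible_dirs_def)
    with True have "- box_bound M < \<eta> $ i"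
      by linarith
    then show ?thesis
      using order_tendstoD(1)[OF lim, of "- box_bound M"] by (auto elim: eventually_mono)
  qed simp
qed

lemma param_box_add:
  assumes "\<eta> \<in> param_box M" "0 \<le> h"
    and "\<And>i. 0 < d $ i \<Longrightarrow> \<eta> $ i + h * d $ i < box_bound M"
    and "\<And>i. d $ i < 0 \<Longrightarrow> - box_bound M < \<eta> $ i + h * d $ i"
  shows "\<eta> + h *\<^sub>R d \<in> param_box M"
proof -
  have "- box_bound M \<le> \<eta> $ i + h * d $ i \<and> \<eta> $ i + h * d $ i \<le> box_bound M" for i
  proof -
    have b: "- box_bound M \<le> \<eta> $ i" "\<eta> $ i \<le> box_bound M"
      using assms(1) by (auto simp: param_box_def)
    consider "0 < d $ i" | "d $ i < 0" | "d $ i = 0"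
      by linarith
    then show ?thesis
    proof cases
      case 1
      then have "0 \<le> h * d $ i"
        using assms(2) by simp
      then show ?thesis
        using b assms(3)[OF 1] by linarith
    next
      case 2
      then have "h * d $ i \<le> 0"
        using assms(2) by (simp add: mult_nonneg_nonpos)
      then show ?thesis
        using b assms(4)[OF 2] by linarith
    qed (use b in simp)
  qed
  then show ?thesis
    by (simp add: param_box_def)
qed

section \<open>Convergence of the ascent\<close>

locale robust_ascent_bounds =
  fixes M :: "('d::finite, 'm::finite, 'n::finite) rmdp" and C1 C2 :: real
  assumes mdp: "finite_robust_mdp M"
    and C1_pos: "0 < C1"
    and gap_lipschitz: "\<And>\<sigma> t x a \<eta> \<eta>'.
          \<lbrakk>\<sigma> \<in> selections M; t < horizon M; x \<in> states M; a \<in> actions M;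
           \<eta> \<in> param_box M; \<eta>' \<in> param_box M\<rbrakk>
          \<Longrightarrow> \<bar>gap M \<sigma> \<eta> t x a - gap M \<sigma> \<eta>' t x a\<bar> \<le> C1 * infnorm (\<eta> - \<eta>')"
    and C2_pos: "0 < C2"
    and quadratic_bound: "\<And>\<sigma> (\<eta> :: real ^ 'n) (d :: real ^ 'n) (h :: real).
          \<lbrakk>\<sigma> \<in> selections M; infnorm d \<le> 1; \<eta> \<in> param_box M; \<eta> + h *\<^sub>R d \<in> param_box M\<rbrakk>
          \<Longrightarrow> \<bar>selection_objective M \<sigma> (\<eta> + h *\<^sub>R d) - selection_objective M \<sigma> \<eta>
                 - h * (gradient (selection_objective M \<sigma>) \<eta> \<bullet> d)\<bar> \<le> C2 * h\<^sup>2"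
begin

abbreviation J :: "real ^ 'n \<Rightarrow> real" where
  "J \<equiv> robust_objective M"

abbreviation F :: "('d, 'm) selection \<Rightarrow> real ^ 'n \<Rightarrow> real" where
  "F \<equiv> selection_objective M"

text \<open>Activity can be transported between parameters: by the Lipschitz bound, the tolerance
  grows by at most \<open>C1\<close> times the distance.\<close>

lemma near_active_shift:
  assumes "\<eta> \<in> param_box M" "\<eta>' \<in> param_box M" "\<sigma> \<in> near_active M z \<eta>'"
    and "z + C1 * infnorm (\<eta> - \<eta>') \<le> z'"
  shows "\<sigma> \<in> near_active M z' \<eta>"
proof -
  have \<sigma>: "\<sigma> \<in> selections M"
    using assms(3) by (rule near_active_selection)
  have "gap M \<sigma> \<eta> t x a \<le> z'" if "t < horizon M" "x \<in> states M" "a \<in> actions M" for t x a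
  proof -
    have "gap M \<sigma> \<eta>' t x a \<le> z"
      using assms(3) that by (simp add: near_active_def)
    then show ?thesis
      using gap_lipschitz[OF \<sigma> that assms(1,2)] assms(4) by linarith
  qed
  then show ?thesis
    using \<sigma> by (simp add: near_active_def)
qed

lemma quadratic_bound_diff:
  assumes "\<sigma> \<in> selections M" "\<eta> \<in> param_box M" "\<eta>' \<in> param_box M"
  shows "\<bar>F \<sigma> \<eta>' - F \<sigma> \<eta> - gradient (F \<sigma>) \<eta> \<bullet> (\<eta>' - \<eta>)\<bar> \<le> C2 * (infnorm (\<eta>' - \<eta>))\<^sup>2"
proof (cases "\<eta>' = \<eta>")
  case False
  define h where "h = infnorm (\<eta>' - \<eta>)"
  define d where "d = (1 / h) *\<^sub>R (\<eta>' - \<eta>)"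
  have "0 < h"
    using False by (simp add: h_def infnorm_pos_lt)
  then have "infnorm d \<le> 1" "h *\<^sub>R d = \<eta>' - \<eta>"
    by (simp_all add: d_def infnorm_mul flip: h_def)
  then show ?thesis
    using quadratic_bound[OF assms(1), of d \<eta> h] assms(2,3)
    by (simp add: h_def flip: inner_scaleR_right)
qed (simp add: infnorm_0)

text \<open>Continuity on the box, read off from the second-order bound expanded at the limit
  point.\<close>

lemma F_tendsto:
  assumes "\<sigma> \<in> selections M" "\<eta> \<in> param_box M" "\<And>j. u j \<in> param_box M" "u \<longlonglongrightarrow> \<eta>"
  shows "(\<lambda>j. F \<sigma> (u j)) \<longlonglongrightarrow> F \<sigma> \<eta>"
proof -
  let ?g = "gradient (F \<sigma>) \<eta>"
  have bound: "norm (F \<sigma> (u j) - F \<sigma> \<eta>) \<le> norm ?g * norm (u j - \<eta>) + C2 * (norm (u j - \<eta>))\<^sup>2" for j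
  proof -
    have "\<bar>?g \<bullet> (u j - \<eta>)\<bar> \<le> norm ?g * norm (u j - \<eta>)"
      by (rule Cauchy_Schwarz_ineq2)
    moreover have "C2 * (infnorm (u j - \<eta>))\<^sup>2 \<le> C2 * (norm (u j - \<eta>))\<^sup>2"
      using C2_pos by (intro mult_left_mono power_mono) (auto simp: infnorm_le_norm infnorm_pos_le)
    ultimately show ?thesis
      using quadratic_bound_diff[OF assms(1,2) assms(3)[of j]] unfolding real_norm_def by linarith
  qed
  have lim: "(\<lambda>j. norm ?g * norm (u j - \<eta>) + C2 * (norm (u j - \<eta>))\<^sup>2) \<longlonglongrightarrow> 0"
  proof -
    have "(\<lambda>j. norm ?g * norm (u j - \<eta>) + C2 * (norm (u j - \<eta>))\<^sup>2)
        \<longlonglongrightarrow> norm ?g * norm (\<eta> - \<eta>) + C2 * (norm (\<eta> - \<eta>))\<^sup>2"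
      using assms(4) by (intro tendsto_intros)
    then show ?thesis
      by simp
  qed
  have "(\<lambda>j. F \<sigma> (u j) - F \<sigma> \<eta>) \<longlonglongrightarrow> 0"
    by (rule Lim_null_comparison[OF always_eventually[OF allI[OF bound]] lim])
  then show ?thesis
    by (rule LIM_zero_cancel)
qed

text \<open>Any one selection objective majorises \<open>J\<close>, and its second-order bound at
  the centre \<open>0\<close> of the box is uniform over the box.\<close>

lemma J_bounded_above: "\<exists>b. \<forall>\<eta>\<in>param_box M. J \<eta> \<le> b"
proof -
  obtain \<sigma> where \<sigma>: "\<sigma> \<in> selections M"
    using near_active_0_nonempty[OF mdp] near_active_selection by blast
  define B where "B = box_bound M"
  have B: "0 < B"
    using finite_robust_mdpD(5)[OF mdp] by (simp add: B_def)
  have 0: "0 \<in> param_box M"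
    using B by (simp add: param_box_def B_def)
  let ?g = "gradient (F \<sigma>) 0"
  have "J \<eta> \<le> F \<sigma> 0 + norm ?g * (sqrt CARD('n) * B) + C2 * B\<^sup>2" if \<eta>: "\<eta> \<in> param_box M" for \<eta>
  proof -
    have i: "infnorm \<eta> \<le> B"
      unfolding infnorm_cart using \<eta>
      by (intro cSup_least) (auto simp: param_box_def B_def abs_le_iff minus_le_iff)
    have "norm \<eta> \<le> sqrt CARD('n) * infnorm \<eta>"
      using norm_le_infnorm[of \<eta>] by simp
    also have "\<dots> \<le> sqrt CARD('n) * B"
      using i by (intro mult_left_mono) auto
    finally have "norm ?g * norm \<eta> \<le> norm ?g * (sqrt CARD('n) * B)"
      by (intro mult_left_mono) auto
    moreover have "C2 * (infnorm \<eta>)\<^sup>2 \<le> C2 * B\<^sup>2"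
      using C2_pos i by (intro mult_left_mono power_mono) (auto simp: infnorm_pos_le)
    moreover have "?g \<bullet> \<eta> \<le> norm ?g * norm \<eta>"
      by (rule norm_cauchy_schwarz)
    moreover have "J \<eta> \<le> F \<sigma> \<eta>"
      by (rule robust_objective_le[OF mdp \<sigma> \<eta>])
    ultimately show ?thesis
      using quadratic_bound_diff[OF \<sigma> 0 \<eta>] by simp
  qed
  then show ?thesis
    by blast
qed

text \<open>Test a selection that is active at the endpoint: there \<open>F \<sigma>\<close> equals
  \<open>J\<close>, while \<open>J \<le> F \<sigma>\<close> at the start. The cap
  \<open>z / C1\<close> makes this selection \<open>z\<close>-active at the start, so its slope is
  at least \<open>min_slope\<close>; the cap with \<open>C2\<close> keeps the quadratic error below
  half of the linear gain.\<close>

lemma ascent_step: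
  assumes \<eta>: "\<eta> \<in> param_box M" and d: "d \<in> feasible_dirs M z \<eta>" and z: "0 < z"
    and slope: "z < min_slope M z \<eta> d"
  defines "h \<equiv> Min {z, z / C1, min_slope M z \<eta> d / (2 * C2)}"
  shows "\<eta> + h *\<^sub>R d \<in> param_box M"
    and "J \<eta> + Min {1, 1 / C1, 1 / (2 * C2)} / 2 * z\<^sup>2 \<le> J (\<eta> + h *\<^sub>R d)"
proof -
  let ?D = "min_slope M z \<eta> d"
  have h: "h \<le> z" "h \<le> z / C1" "h \<le> ?D / (2 * C2)"
    by (simp_all add: h_def)
  have "0 < ?D"
    using z slope by simp
  then have h_pos: "0 < h"
    using z C1_pos C2_pos by (simp add: h_def)
  show box: "\<eta> + h *\<^sub>R d \<in> param_box M"
    using h h_pos by (intro param_box_add_feasible[OF \<eta> d]) auto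
  have d1: "infnorm d \<le> 1"
    using d by (simp add: feasible_dirs_def)
  obtain \<sigma> where \<sigma>: "\<sigma> \<in> near_active M 0 (\<eta> + h *\<^sub>R d)"
    using near_active_0_nonempty[OF mdp] by blast
  have sel: "\<sigma> \<in> selections M"
    using \<sigma> by (rule near_active_selection)
  have "infnorm (\<eta> - (\<eta> + h *\<^sub>R d)) \<le> h"
    using h_pos d1 by (simp add: infnorm_neg infnorm_mul)
  then have "C1 * infnorm (\<eta> - (\<eta> + h *\<^sub>R d)) \<le> C1 * h"
    using C1_pos by (intro mult_left_mono) auto
  also have "\<dots> \<le> z"
    using h(2) C1_pos by (simp add: field_simps)
  finally have "\<sigma> \<in> near_active M z \<eta>"
    by (intro near_active_shift[OF \<eta> box \<sigma>]) simp
  then have "?D \<le> gradient (F \<sigma>) \<eta> \<bullet> d"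
    by (rule min_slope_le[OF mdp])
  then have "h * ?D \<le> h * (gradient (F \<sigma>) \<eta> \<bullet> d)"
    using h_pos by simp
  moreover have "C2 * h\<^sup>2 \<le> h * ?D / 2"
  proof -
    have "C2 * h \<le> ?D / 2"
      using h(3) C2_pos by (simp add: field_simps)
    then have "h * (C2 * h) \<le> h * (?D / 2)"
      using h_pos by (intro mult_left_mono) auto
    then show ?thesis
      by (simp add: power2_eq_square mult_ac)
  qed
  moreover have "J (\<eta> + h *\<^sub>R d) = F \<sigma> (\<eta> + h *\<^sub>R d)"
    by (rule near_active_0_objective[OF mdp \<sigma> box, symmetric])
  moreover have "J \<eta> \<le> F \<sigma> \<eta>"
    by (rule robust_objective_le[OF mdp sel \<eta>])
  ultimately have "J \<eta> + h * ?D / 2 \<le> J (\<eta> + h *\<^sub>R d)"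
    using quadratic_bound[OF sel d1 \<eta> box] by linarith
  \<comment> \<open>Each of the three caps on \<open>h\<close> is at least \<open>c * z\<close>, the
    third one because the slope exceeds \<open>z\<close>; the second factor \<open>z\<close> again
    comes from the slope.\<close>
  moreover have "Min {1, 1 / C1, 1 / (2 * C2)} / 2 * z\<^sup>2 \<le> h * ?D / 2"
  proof -
    define c where "c = Min {1, 1 / C1, 1 / (2 * C2)}"
    have c: "c \<le> 1" "c \<le> 1 / C1" "c \<le> 1 / (2 * C2)"
      by (simp_all add: c_def)
    have "0 < c"
      using C1_pos C2_pos by (simp add: c_def)
    have "c * z \<le> z" "c * z \<le> z / C1" "c * z \<le> z / (2 * C2)"
      using mult_right_mono[OF c(1), of z] mult_right_mono[OF c(2), of z]
        mult_right_mono[OF c(3), of z] z by simp_all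
    moreover have "z / (2 * C2) \<le> ?D / (2 * C2)"
      using slope C2_pos by (intro divide_right_mono) auto
    ultimately have "c * z \<le> h"
      by (simp add: h_def)
    then have "(c * z) * z \<le> h * ?D"
      using slope z h_pos by (intro mult_mono) auto
    then show ?thesis
      unfolding c_def[symmetric] by (simp add: power2_eq_square mult_ac)
  qed
  ultimately show "J \<eta> + Min {1, 1 / C1, 1 / (2 * C2)} / 2 * z\<^sup>2 \<le> J (\<eta> + h *\<^sub>R d)"
    by linarith
qed

text \<open>Danskin's rule, which needs only the second-order bounds because the minimum is over finitely
  many selections.\<close>

lemma right_dir_derivative:
  assumes \<eta>: "\<eta> \<in> param_box M" and d: "d \<in> feasible_dirs M 0 \<eta>"
  shows "has_right_dir_derivative J \<eta> d (min_slope M 0 \<eta> d)"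
proof -
  let ?m = "min_slope M 0 \<eta> d"
  let ?q = "\<lambda>h. (J (\<eta> + h *\<^sub>R d) - J \<eta>) / h"
  have d1: "infnorm d \<le> 1"
    using d by (simp add: feasible_dirs_def)
  have pos: "\<forall>\<^sub>F h in at_right (0::real). 0 < h"
    by (simp add: eventually_at_right_less)
  have box: "\<forall>\<^sub>F h in at_right 0. \<eta> + h *\<^sub>R d \<in> param_box M"
    using feasible_dirs_0_interior[OF \<eta> d] pos
    by eventually_elim (intro param_box_add[OF \<eta>], auto)
  \<comment> \<open>For the upper estimate: \<open>F \<tau>\<close> touches \<open>J\<close> at
    \<open>\<eta>\<close>, majorises it on the box and has the minimal slope.\<close>
  obtain \<tau> where \<tau>: "\<tau> \<in> near_active M 0 \<eta>" "gradient (F \<tau>) \<eta> \<bullet> d = ?m"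
    by (rule min_slope_attained[OF mdp order_refl])
  have upper: "\<forall>\<^sub>F h in at_right 0. ?q h \<le> ?m + C2 * h"
    using box pos
  proof eventually_elim
    case (elim h)
    have sel: "\<tau> \<in> selections M"
      using \<tau>(1) by (rule near_active_selection)
    have "J (\<eta> + h *\<^sub>R d) \<le> F \<tau> (\<eta> + h *\<^sub>R d)"
      by (rule robust_objective_le[OF mdp sel elim(1)])
    moreover have "F \<tau> \<eta> = J \<eta>"
      by (rule near_active_0_objective[OF mdp \<tau>(1) \<eta>])
    ultimately have "J (\<eta> + h *\<^sub>R d) - J \<eta> \<le> (?m + C2 * h) * h"
      using quadratic_bound[OF sel d1 \<eta> elim(1)] \<tau>(2)
      by (simp add: power2_eq_square algebra_simps)
    then show ?case
      using elim(2) by (simp add: pos_divide_le_eq)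
  qed
  \<comment> \<open>A selection active at \<open>\<eta> + h *\<^sub>R d\<close> is
    \<open>C1 * h\<close>-active at \<open>\<eta>\<close>, hence exactly active there once
    \<open>h\<close> is small. The lower estimate uses such a selection, which varies with
    \<open>h\<close>.\<close>
  have "((\<lambda>h. C1 * h) \<longlongrightarrow> C1 * 0) (at_right 0)"
    by (intro tendsto_intros)
  moreover have "\<forall>\<^sub>F h in at_right 0. C1 * h \<in> {0<..} \<and> C1 * h \<noteq> 0"
    using pos by eventually_elim (use C1_pos in simp)
  ultimately have "filterlim (\<lambda>h. C1 * h) (at_right 0) (at_right 0)"
    unfolding filterlim_at by simp
  from eventually_compose_filterlim[OF near_active_eventually_0[OF mdp] this]
  have active: "\<forall>\<^sub>F h in at_right 0. near_active M (C1 * h) \<eta> \<subseteq> near_active M 0 \<eta>" .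
  have lower: "\<forall>\<^sub>F h in at_right 0. ?m - C2 * h \<le> ?q h"
    using box pos active
  proof eventually_elim
    case (elim h)
    obtain \<sigma> where \<sigma>: "\<sigma> \<in> near_active M 0 (\<eta> + h *\<^sub>R d)"
      using near_active_0_nonempty[OF mdp] by blast
    have sel: "\<sigma> \<in> selections M"
      using \<sigma> by (rule near_active_selection)
    have "infnorm (\<eta> - (\<eta> + h *\<^sub>R d)) \<le> h"
      using elim(2) d1 by (simp add: infnorm_neg infnorm_mul)
    then have "\<sigma> \<in> near_active M (C1 * h) \<eta>"
      using C1_pos by (intro near_active_shift[OF \<eta> elim(1) \<sigma>]) simp
    then have "?m \<le> gradient (F \<sigma>) \<eta> \<bullet> d"
      using elim(3) by (intro min_slope_le[OF mdp]) blast
    then have "h * ?m \<le> h * (gradient (F \<sigma>) \<eta> \<bullet> d)"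
      using elim(2) by simp
    moreover have "J (\<eta> + h *\<^sub>R d) = F \<sigma> (\<eta> + h *\<^sub>R d)"
      by (rule near_active_0_objective[OF mdp \<sigma> elim(1), symmetric])
    moreover have "J \<eta> \<le> F \<sigma> \<eta>"
      by (rule robust_objective_le[OF mdp sel \<eta>])
    ultimately have "h * ?m - C2 * h\<^sup>2 \<le> J (\<eta> + h *\<^sub>R d) - J \<eta>"
      using quadratic_bound[OF sel d1 \<eta> elim(1)] by linarith
    then have "(?m - C2 * h) * h \<le> J (\<eta> + h *\<^sub>R d) - J \<eta>"
      by (simp add: power2_eq_square algebra_simps)
    then show ?case
      using elim(2) by (simp add: pos_le_divide_eq)
  qed
  have "((\<lambda>h. ?m - C2 * h) \<longlongrightarrow> ?m - C2 * 0) (at_right 0)"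
    "((\<lambda>h. ?m + C2 * h) \<longlongrightarrow> ?m + C2 * 0) (at_right 0)"
    by (intro tendsto_intros)+
  then show ?thesis
    unfolding has_right_dir_derivative_def
    using tendsto_sandwich[OF lower upper] by simp
qed

section \<open>Passage to the limit along refinements\<close>

text \<open>The limit is taken in function values rather than in gradients. For fixed
  \<open>h\<close>, the second-order bound at \<open>u j\<close> passes to \<open>\<eta>\<close> by
  continuity of each \<open>F \<sigma>\<close>; only then does \<open>h\<close> tend to 0, and
  \<open>right_dir_derivative\<close> identifies the slope.\<close>

lemma limit_of_refinements:
  assumes u: "\<And>j. u j \<in> param_box M" and lim: "u \<longlonglongrightarrow> \<eta>"
    and z: "\<And>j. 0 < z j" "z \<longlonglongrightarrow> 0"
    and slope: "\<And>j d. d \<in> feasible_dirs M (z j) (u j) \<Longrightarrow> min_slope M (z j) (u j) d \<le> z j"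
    and d: "d \<in> feasible_dirs M 0 \<eta>"
  shows "min_slope M 0 \<eta> d \<le> 0"
proof -
  have \<eta>: "\<eta> \<in> param_box M"
    using closed_sequentially[OF closed_param_box u lim] .
  have d1: "infnorm d \<le> 1"
    using d by (simp add: feasible_dirs_def)
  have coord: "(\<lambda>j. u j $ i) \<longlonglongrightarrow> \<eta> $ i" for i
    using lim by (rule tendsto_vec_nth)
  \<comment> \<open>If \<open>d\<close> moves a coordinate towards a bound, \<open>\<eta>\<close>
    has positive distance from that bound, which eventually exceeds \<open>z j\<close> at
    \<open>u j\<close> as well.\<close>
  have feas: "\<forall>\<^sub>F j in sequentially. d \<in> feasible_dirs M (z j) (u j)"
  proof -
    have "\<forall>\<^sub>F j in sequentially. (u j $ i \<ge> box_bound M - z j \<longrightarrow> d $ i \<le> 0) \<and>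
        (u j $ i \<le> - box_bound M + z j \<longrightarrow> d $ i \<ge> 0)" for i
    proof (intro eventually_conj)
      show "\<forall>\<^sub>F j in sequentially. u j $ i \<ge> box_bound M - z j \<longrightarrow> d $ i \<le> 0"
      proof (cases "d $ i \<le> 0")
        case False
        have "box_bound M - 0 \<le> \<eta> $ i \<Longrightarrow> d $ i \<le> 0"
          using d by (simp add: feasible_dirs_def)
        with False have "\<eta> $ i + 0 < box_bound M"
          by linarith
        with tendsto_add[OF coord z(2)]
        have "\<forall>\<^sub>F j in sequentially. u j $ i + z j < box_bound M"
          by (rule order_tendstoD(2))
        then show ?thesis
          by eventually_elim linarith
      qed simp
      show "\<forall>\<^sub>F j in sequentially. u j $ i \<le> - box_bound M + z j \<longrightarrow> d $ i \<ge> 0"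
      proof (cases "d $ i \<ge> 0")
        case False
        have "\<eta> $ i \<le> - box_bound M + 0 \<Longrightarrow> d $ i \<ge> 0"
          using d by (simp add: feasible_dirs_def)
        with False have "- box_bound M < \<eta> $ i - 0"
          by linarith
        with tendsto_diff[OF coord z(2)]
        have "\<forall>\<^sub>F j in sequentially. - box_bound M < u j $ i - z j"
          by (rule order_tendstoD(1))
        then show ?thesis
          by eventually_elim linarith
      qed simp
    qed
    then have "\<forall>\<^sub>F j in sequentially. \<forall>i. (u j $ i \<ge> box_bound M - z j \<longrightarrow> d $ i \<le> 0) \<and>
        (u j $ i \<le> - box_bound M + z j \<longrightarrow> d $ i \<ge> 0)"
      by (rule eventually_all_finite)
    then show ?thesis
      by eventually_elim (simp add: feasible_dirs_def d1)
  qed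
  have active: "\<forall>\<^sub>F j in sequentially. near_active M (z j) (u j) \<subseteq> near_active M 0 \<eta>"
  proof -
    \<comment> \<open>A tolerance at which every \<open>z j\<close>-active selection at
      \<open>u j\<close> is active at \<open>\<eta>\<close>. It is positive and tends to 0, so
      eventually it admits only exactly active selections.\<close>
    let ?w = "\<lambda>j. z j + C1 * norm (\<eta> - u j)"
    have "?w \<longlonglongrightarrow> 0 + C1 * norm (\<eta> - \<eta>)"
      using lim z(2) by (intro tendsto_intros)
    moreover have "0 < ?w j" for j
      using z(1)[of j] C1_pos by (simp add: add_pos_nonneg)
    ultimately have "filterlim ?w (at_right 0) sequentially"
      unfolding filterlim_at by (simp add: less_imp_neq[symmetric])
    from eventually_compose_filterlim[OF near_active_eventually_0[OF mdp] this]
    have "\<forall>\<^sub>F j in sequentially. near_active M (?w j) \<eta> \<subseteq> near_active M 0 \<eta>" .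
    then show ?thesis
    proof eventually_elim
      case (elim j)
      have "C1 * infnorm (\<eta> - u j) \<le> C1 * norm (\<eta> - u j)"
        using C1_pos infnorm_le_norm by (intro mult_left_mono) auto
      then have "near_active M (z j) (u j) \<subseteq> near_active M (?w j) \<eta>"
        using near_active_shift[OF \<eta> u] by (intro subsetI) simp
      then show ?case
        using elim by blast
    qed
  qed
  have bound: "(J (\<eta> + h *\<^sub>R d) - J \<eta>) / h \<le> (2 + h + C2) * h"
    if h: "0 < h" and int: "\<forall>i. (0 < d $ i \<longrightarrow> \<eta> $ i + h * d $ i < box_bound M) \<and>
           (d $ i < 0 \<longrightarrow> - box_bound M < \<eta> $ i + h * d $ i)" for h
  proof -
    have box: "\<eta> + h *\<^sub>R d \<in> param_box M"
      using h int by (intro param_box_add[OF \<eta>]) auto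
    have "\<forall>\<^sub>F j in sequentially. (0 < d $ i \<longrightarrow> u j $ i + h * d $ i < box_bound M) \<and>
           (d $ i < 0 \<longrightarrow> - box_bound M < u j $ i + h * d $ i)" for i
    proof -
      have c: "(\<lambda>j. u j $ i + h * d $ i) \<longlonglongrightarrow> \<eta> $ i + h * d $ i"
        by (intro tendsto_intros coord)
      show ?thesis
        using order_tendstoD(1)[OF c, of "- box_bound M"] order_tendstoD(2)[OF c, of "box_bound M"] int
        by (intro eventually_conj) (cases "0 < d $ i"; cases "d $ i < 0"; simp)+
    qed
    then have "\<forall>\<^sub>F j in sequentially. \<forall>i. (0 < d $ i \<longrightarrow> u j $ i + h * d $ i < box_bound M) \<and>
           (d $ i < 0 \<longrightarrow> - box_bound M < u j $ i + h * d $ i)"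
      by (rule eventually_all_finite)
    then have boxj: "\<forall>\<^sub>F j in sequentially. u j + h *\<^sub>R d \<in> param_box M"
      by eventually_elim (use h in \<open>intro param_box_add[OF u], auto\<close>)
    \<comment> \<open>The continuity errors at both ends and the tolerance \<open>z j\<close> are
      all pushed below \<open>h\<^sup>2\<close>, so that the total error is still of order
      \<open>h\<close> after division by \<open>h\<close>.\<close>
    define e where "e = h\<^sup>2"
    have e: "0 < e"
      using h by (simp add: e_def)
    \<comment> \<open>\<open>F_tendsto\<close> wants every term in the box; the default replaces the
      finitely many endpoints that may lie outside.\<close>
    define v where "v j = (if u j + h *\<^sub>R d \<in> param_box M then u j + h *\<^sub>R d else \<eta> + h *\<^sub>R d)" for j
    have "v \<longlonglongrightarrow> \<eta> + h *\<^sub>R d"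
    proof (rule Lim_transform_eventually)
      show "(\<lambda>j. u j + h *\<^sub>R d) \<longlonglongrightarrow> \<eta> + h *\<^sub>R d"
        by (intro tendsto_intros lim)
      show "\<forall>\<^sub>F j in sequentially. u j + h *\<^sub>R d = v j"
        using boxj by eventually_elim (simp add: v_def)
    qed
    moreover have "v j \<in> param_box M" for j
      using box by (simp add: v_def)
    ultimately have "\<forall>\<^sub>F j in sequentially. F \<sigma> (\<eta> + h *\<^sub>R d) - e < F \<sigma> (v j)" if "\<sigma> \<in> selections M" for \<sigma>
      using order_tendstoD(1)[OF F_tendsto[OF that box], of v "F \<sigma> (\<eta> + h *\<^sub>R d) - e"] e by simp
    then have cont_v: "\<forall>\<^sub>F j in sequentially. \<forall>\<sigma>\<in>selections M. F \<sigma> (\<eta> + h *\<^sub>R d) - e < F \<sigma> (v j)"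
      using finite_selections[OF mdp] by (intro eventually_ball_finite) auto
    have "\<forall>\<^sub>F j in sequentially. F \<sigma> (u j) < F \<sigma> \<eta> + e" if "\<sigma> \<in> selections M" for \<sigma>
      using order_tendstoD(2)[OF F_tendsto[OF that \<eta> u lim], of "F \<sigma> \<eta> + e"] e by simp
    then have cont_u: "\<forall>\<^sub>F j in sequentially. \<forall>\<sigma>\<in>selections M. F \<sigma> (u j) < F \<sigma> \<eta> + e"
      using finite_selections[OF mdp] by (intro eventually_ball_finite) auto
    have "\<forall>\<^sub>F j in sequentially. z j < e"
      using order_tendstoD(2)[OF z(2) e] .
    then have "\<forall>\<^sub>F j in sequentially. J (\<eta> + h *\<^sub>R d) - e \<le> J \<eta> + e + h * e + C2 * h\<^sup>2"
      using boxj cont_v cont_u feas active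
    proof eventually_elim
      case (elim j)
      \<comment> \<open>This minimiser depends on \<open>j\<close>, which is why the two continuity
        estimates were made uniform over \<open>selections M\<close>.\<close>
      obtain \<sigma> where \<sigma>: "\<sigma> \<in> near_active M (z j) (u j)"
          "gradient (F \<sigma>) (u j) \<bullet> d = min_slope M (z j) (u j) d"
        by (rule min_slope_attained[OF mdp less_imp_le[OF z(1)]])
      have sel: "\<sigma> \<in> selections M"
        using \<sigma>(1) by (rule near_active_selection)
      have "gradient (F \<sigma>) (u j) \<bullet> d \<le> e"
        using \<sigma>(2) slope[OF elim(5)] elim(1) by linarith
      then have "h * (gradient (F \<sigma>) (u j) \<bullet> d) \<le> h * e"
        using h by simp
      moreover have "F \<sigma> (u j + h *\<^sub>R d) - F \<sigma> (u j) - h * (gradient (F \<sigma>) (u j) \<bullet> d) \<le> C2 * h\<^sup>2"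
        using quadratic_bound[OF sel d1 u elim(2)] by linarith
      moreover have "F \<sigma> (\<eta> + h *\<^sub>R d) - e < F \<sigma> (u j + h *\<^sub>R d)"
        using elim(2,3) sel by (auto simp: v_def)
      moreover have "F \<sigma> (u j) < F \<sigma> \<eta> + e"
        using elim(4) sel by blast
      moreover have "F \<sigma> \<eta> = J \<eta>"
        using near_active_0_objective[OF mdp _ \<eta>] elim(6) \<sigma>(1) by blast
      moreover have "J (\<eta> + h *\<^sub>R d) \<le> F \<sigma> (\<eta> + h *\<^sub>R d)"
        by (rule robust_objective_le[OF mdp sel box])
      ultimately show ?case
        by linarith
    qed
    \<comment> \<open>The inequality no longer involves \<open>j\<close>, so holding eventually
      means holding.\<close>
    then have "J (\<eta> + h *\<^sub>R d) - e \<le> J \<eta> + e + h * e + C2 * h\<^sup>2"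
      by simp
    then have "J (\<eta> + h *\<^sub>R d) - J \<eta> \<le> ((2 + h + C2) * h) * h"
      by (simp add: e_def power2_eq_square algebra_simps)
    then show ?thesis
      using h by (simp add: pos_divide_le_eq)
  qed
  have "\<forall>\<^sub>F h in at_right (0::real). 0 < h"
    by (simp add: eventually_at_right_less)
  with feasible_dirs_0_interior[OF \<eta> d]
  have "\<forall>\<^sub>F h in at_right 0. (J (\<eta> + h *\<^sub>R d) - J \<eta>) / h \<le> (2 + h + C2) * h"
    by eventually_elim (rule bound)
  moreover have "((\<lambda>h. (2 + h + C2) * h) \<longlongrightarrow> (2 + 0 + C2) * 0) (at_right 0)"
    by (intro tendsto_intros)
  ultimately have "min_slope M 0 \<eta> d \<le> (2 + 0 + C2) * 0"
    using right_dir_derivative[OF \<eta> d] unfolding has_right_dir_derivative_def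
    by (intro tendsto_le[OF trivial_limit_at_right_real])
  then show ?thesis
    by simp
qed

end

section \<open>Analysis of a run of the algorithm\<close>

locale robust_ascent_run = robust_ascent_bounds M C1 C2
  for M :: "('d::finite, 'm::finite, 'n::finite) rmdp" and C1 C2 :: real +
  fixes \<nu> :: real and \<theta> r :: "nat \<Rightarrow> real ^ 'n" and \<zeta> :: "nat \<Rightarrow> real"
  assumes alg: "robust_policy_ascent M C1 C2 \<nu> \<theta> \<zeta> r"
begin

abbreviation R :: "nat set" where
  "R \<equiv> refinement_iterations M \<theta> \<zeta>"

lemma start: "\<theta> 0 \<in> param_box M" "0 < \<zeta> 0" "0 < \<nu>" "\<nu> < 1"
  using alg by (simp_all add: robust_policy_ascent_def)

lemma direction_feasible: "r k \<in> feasible_dirs M (\<zeta> k) (\<theta> k)"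
  and direction_max:
    "d \<in> feasible_dirs M (\<zeta> k) (\<theta> k) \<Longrightarrow> min_slope M (\<zeta> k) (\<theta> k) d \<le> min_slope M (\<zeta> k) (\<theta> k) (r k)"
  using alg by (simp_all add: robust_policy_ascent_def Let_def is_arg_max_linorder)

lemma ascent_slope_eq: "ascent_slope M (\<zeta> k) (\<theta> k) = min_slope M (\<zeta> k) (\<theta> k) (r k)"
  unfolding ascent_slope_def
  using direction_feasible direction_max by (intro cSup_eq_maximum) auto

lemma refinement_iff: "k \<in> R \<longleftrightarrow> min_slope M (\<zeta> k) (\<theta> k) (r k) \<le> \<zeta> k"
  by (simp add: refinement_iterations_def ascent_slope_eq)

lemma refinement_step:
  assumes "k \<in> R"
  shows "\<theta> (Suc k) = \<theta> k" "\<zeta> (Suc k) = \<nu> * \<zeta> k"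
  using alg assms unfolding robust_policy_ascent_def refinement_iterations_def Let_def by auto

lemma ascent_iteration:
  assumes "k \<notin> R"
  shows "\<theta> (Suc k) = \<theta> k +
           Min {\<zeta> k, \<zeta> k / C1, min_slope M (\<zeta> k) (\<theta> k) (r k) / (2 * C2)} *\<^sub>R r k"
    and "\<zeta> (Suc k) = \<zeta> k"
  using alg assms unfolding robust_policy_ascent_def refinement_iterations_def Let_def
  by (simp_all add: ascent_slope_eq)

lemma iterates: "\<theta> k \<in> param_box M \<and> 0 < \<zeta> k"
proof (induction k)
  case (Suc k)
  show ?case
  proof (cases "k \<in> R")
    case False
    then show ?thesis
      using ascent_step(1)[OF _ direction_feasible] Suc ascent_iteration[OF False]
      by (simp add: refinement_iff not_le)
  qed (use Suc refinement_step start in simp)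
qed (use start in simp)

lemma ascent_increase:
  assumes "k \<notin> R"
  shows "J (\<theta> k) + Min {1, 1 / C1, 1 / (2 * C2)} / 2 * (\<zeta> k)\<^sup>2 \<le> J (\<theta> (Suc k))"
  unfolding ascent_iteration(1)[OF assms]
  using iterates[of k] assms direction_feasible
  by (intro ascent_step(2)) (simp_all add: refinement_iff)

lemma gain_pos: "0 < Min {1, 1 / C1, 1 / (2 * C2)} / 2"
  using C1_pos C2_pos by simp

lemma incseq_J: "incseq (\<lambda>k. J (\<theta> k))"
proof (rule incseq_SucI)
  fix k
  show "J (\<theta> k) \<le> J (\<theta> (Suc k))"
  proof (cases "k \<in> R")
    case False
    have "0 \<le> Min {1, 1 / C1, 1 / (2 * C2)} / 2 * (\<zeta> k)\<^sup>2"
      using gain_pos by (intro mult_nonneg_nonneg) simp_all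
    then show ?thesis
      using ascent_increase[OF False] by linarith
  qed (simp add: refinement_step)
qed

lemma convergent_J: "convergent (\<lambda>k. J (\<theta> k))"
proof -
  obtain b where "\<And>k. J (\<theta> k) \<le> b"
    using J_bounded_above iterates by blast
  then show ?thesis
    using incseq_convergent[OF incseq_J] by (metis convergentI)
qed

text \<open>After a last refinement the tolerance would be frozen and every step would raise
  \<open>J\<close> by at least the same \<open>g > 0\<close>, against boundedness.\<close>

lemma infinite_refinements: "infinite R"
proof
  assume "finite R"
  then obtain N where N: "\<And>k. k \<ge> N \<Longrightarrow> k \<notin> R"
    using finite_nat_set_iff_bounded_le by (metis Suc_n_not_le_n dual_order.trans mem_Collect_eq)
  obtain b where b: "\<And>k. J (\<theta> k) \<le> b"
    using J_bounded_above iterates by blast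
  define g where "g = Min {1, 1 / C1, 1 / (2 * C2)} / 2 * (\<zeta> N)\<^sup>2"
  have "0 < g"
    unfolding g_def using gain_pos iterates[of N] by (intro mult_pos_pos) simp_all
  have "\<zeta> (N + n) = \<zeta> N \<and> J (\<theta> N) + n * g \<le> J (\<theta> (N + n))" for n
  proof (induction n)
    case (Suc n)
    have "N + n \<notin> R"
      by (rule N) simp
    moreover have "J (\<theta> (N + n)) + g \<le> J (\<theta> (Suc (N + n)))"
      using ascent_increase[OF calculation] Suc unfolding g_def by simp
    ultimately show ?case
      using ascent_iteration(2)[of "N + n"] Suc by (simp add: algebra_simps)
  qed simp
  moreover obtain n where "b - J (\<theta> N) < of_nat n * g"
    using ex_less_of_nat_mult[OF \<open>0 < g\<close>] by blast
  ultimately show False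
    using b[of "N + n"] by (smt (verit))
qed

text \<open>The tolerances decrease to some limit \<open>L\<close>. Comparing refinement indices
  with their successors gives \<open>L = \<nu> * L\<close>, and \<open>\<nu> < 1\<close> leaves only
  \<open>L = 0\<close>.\<close>

lemma tolerance_tendsto_0: "\<zeta> \<longlonglongrightarrow> 0"
proof -
  have "\<zeta> (Suc k) \<le> \<zeta> k" for k
  proof (cases "k \<in> R")
    case True
    then show ?thesis
      using refinement_step(2)[OF True] start iterates[of k] by simp
  qed (simp add: ascent_iteration)
  then have "decseq \<zeta>"
    by (rule decseq_SucI)
  then obtain L where L: "\<zeta> \<longlonglongrightarrow> L"
    using decseq_convergent[of \<zeta> 0] iterates less_imp_le by metis
  define e where "e = enumerate R"
  have e: "strict_mono e" "\<And>n. e n \<in> R"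
    unfolding e_def using infinite_refinements by (auto intro: strict_mono_enumerate enumerate_in_set)
  have "strict_mono (\<lambda>n. Suc (e n))"
    using e(1) by (simp add: strict_mono_def)
  from LIMSEQ_subseq_LIMSEQ[OF L this] have "(\<lambda>n. \<nu> * \<zeta> (e n)) \<longlonglongrightarrow> L"
    using refinement_step(2)[OF e(2)] by (simp add: o_def)
  moreover have "(\<lambda>n. \<nu> * \<zeta> (e n)) \<longlonglongrightarrow> \<nu> * L"
    using LIMSEQ_subseq_LIMSEQ[OF L e(1)] by (intro tendsto_intros) (simp add: o_def)
  ultimately have "L = \<nu> * L"
    by (rule LIMSEQ_unique)
  then show ?thesis
    using L start(4) by simp
qed

text \<open>At a refinement the maximal slope is at most \<open>\<zeta>\<close>, so every feasible
  direction satisfies the slope hypothesis of \<open>limit_of_refinements\<close>.\<close>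

lemma accumulation_stationary:
  assumes s: "strict_mono s" "\<And>j. s j \<in> R" and lim: "(\<lambda>j. \<theta> (s j)) \<longlonglongrightarrow> \<eta>"
    and d: "d \<in> feasible_dirs M 0 \<eta>"
  shows "has_right_dir_derivative J \<eta> d (min_slope M 0 \<eta> d) \<and> min_slope M 0 \<eta> d \<le> 0"
proof
  have box: "\<theta> (s j) \<in> param_box M" and pos: "0 < \<zeta> (s j)" for j
    using iterates by auto
  have "\<eta> \<in> param_box M"
    using closed_sequentially[OF closed_param_box box lim] .
  then show "has_right_dir_derivative J \<eta> d (min_slope M 0 \<eta> d)"
    using d by (rule right_dir_derivative)
  have "(\<lambda>j. \<zeta> (s j)) \<longlonglongrightarrow> 0"
    using LIMSEQ_subseq_LIMSEQ[OF tolerance_tendsto_0 s(1)] by (simp add: o_def)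
  moreover have "min_slope M (\<zeta> (s j)) (\<theta> (s j)) d' \<le> \<zeta> (s j)"
    if "d' \<in> feasible_dirs M (\<zeta> (s j)) (\<theta> (s j))" for j d'
    using direction_max[OF that] s(2)[of j] by (simp add: refinement_iff)
  ultimately show "min_slope M 0 \<eta> d \<le> 0"
    using limit_of_refinements[of "\<lambda>j. \<theta> (s j)" \<eta> "\<lambda>j. \<zeta> (s j)" d] box lim pos d by blast
qed

end

text \<open>Accumulation points are encoded as limits along strictly increasing refinement indices,
  so a value that recurs infinitely often counts as one.\<close>

theorem theorem3p4:
  fixes M :: "('d::finite, 'm::finite, 'n::finite) rmdp"
    and C1 C2 \<nu> :: real
    and \<theta> r :: "nat \<Rightarrow> real ^ 'n"
    and \<zeta> :: "nat \<Rightarrow> real"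
  assumes mdp: "finite_robust_mdp M"
    and C1_pos: "0 < C1"
    and C1_bound: "\<And>\<sigma> t x a \<eta> \<eta>'.
          \<lbrakk>\<sigma> \<in> selections M; t < horizon M; x \<in> states M; a \<in> actions M;
           \<eta> \<in> param_box M; \<eta>' \<in> param_box M\<rbrakk>
          \<Longrightarrow> \<bar>gap M \<sigma> \<eta> t x a - gap M \<sigma> \<eta>' t x a\<bar> \<le> C1 * infnorm (\<eta> - \<eta>')"
    and C2_pos: "0 < C2"
    and C2_bound: "\<And>\<sigma> (\<eta> :: real ^ 'n) (d :: real ^ 'n) (h :: real).
          \<lbrakk>\<sigma> \<in> selections M; infnorm d \<le> 1; \<eta> \<in> param_box M; \<eta> + h *\<^sub>R d \<in> param_box M\<rbrakk>
          \<Longrightarrow> \<bar>selection_objective M \<sigma> (\<eta> + h *\<^sub>R d) - selection_objective M \<sigma> \<eta>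
                 - h * (gradient (selection_objective M \<sigma>) \<eta> \<bullet> d)\<bar> \<le> C2 * h\<^sup>2"
    and alg: "robust_policy_ascent M C1 C2 \<nu> \<theta> \<zeta> r"
  shows "incseq (\<lambda>k. robust_objective M (\<theta> k))
       \<and> convergent (\<lambda>k. robust_objective M (\<theta> k))
       \<and> infinite (refinement_iterations M \<theta> \<zeta>)
       \<and> \<zeta> \<longlonglongrightarrow> 0
       \<and> (\<forall>\<theta>bar s. strict_mono s \<and> (\<forall>j. s j \<in> refinement_iterations M \<theta> \<zeta>)
               \<and> (\<lambda>j. \<theta> (s j)) \<longlonglongrightarrow> \<theta>bar
             \<longrightarrow> (\<forall>d\<in>feasible_dirs M 0 \<theta>bar.
                   \<exists>D. has_right_dir_derivative (robust_objective M) \<theta>bar d D \<and> D \<le> 0))"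
proof -
  interpret robust_ascent_run M C1 C2 \<nu> \<theta> r \<zeta>
    using assms by unfold_locales
  show ?thesis
    using incseq_J convergent_J infinite_refinements tolerance_tendsto_0 accumulation_stationary
    by blast
qed

end
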